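(* The axiomatic system $\mathsf{ConSHN\text{-}BT}$ is sound and complete with respect to validity: for every $\phi\in\Phi$, $\phi$ is derivable in $\mathsf{ConSHN\text{-}BT}$ if and only if $\phi$ is valid.
   Context: Let $\mathsf{AP}$ be a countable set of atomic propositions. The language $\Phi_{XY}$ is given by $\alpha ::= p \mid \bot \mid \neg\alpha \mid (\alpha\land\alpha) \mid \mathtt{X}\alpha \mid \mathtt{Y}\alpha$ with $p\in\mathsf{AP}$; $\Phi_{PL}\subseteq\Phi_{XY}$ is the propositional language (no $\mathtt{X},\mathtt{Y}$). The language $\Phi$ is given by $\phi ::= p \mid \bot \mid \neg\phi \mid (\phi\land\phi) \mid \mathtt{X}\phi \mid \mathtt{Y}\phi \mid [\alpha]\phi$ with $\alpha\in\Phi_{XY}$. Abbreviations: $\top,\lor,\rightarrow,\leftrightarrow$ as usual; $\langle\alpha\rangle\phi:=\neg[\alpha]\neg\phi$; $\Box\phi:=[\top]\phi$; $\Diamond\phi:=\neg\Box\neg\phi$. Closed formulas: $\chi ::= [\alpha]\phi \mid \neg\chi \mid (\chi\land\chi)$. Semantics: a model is $M=(W,<,V)$ where $W$ is a nonempty set, $<$ is a serial binary relation on $W$ such that there is $r\in W$ (the root) with: for every $w\in W$ there is a unique finite sequence $x_0,\dots,x_n$ with $x_0=r$, $x_n=w$, $x_0<\dots<x_n$; and $V:\mathsf{AP}\to\mathcal P(W)$. A timeline is an infinite sequence $\pi=x_0,x_1,\dots$ with $x_0=r$, $x_k<x_{k+1}$; $\pi[i]:=x_i$; $TL(M)$ is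 the set of timelines. A context is a finite (possibly empty) set $C$ of subsets of $TL(M)$; $AT(C):=TL(M)\cap\bigcap_{R\in C}R$. A contextualized pointed model is $(M,C,\pi,i)$ with $\pi\in AT(C)$, $i\in\mathbb N$. Satisfaction: $p$ iff $\pi[i]\in V(p)$; $\bot$ never; $\neg,\land$ classically; $\mathtt{X}\phi$ iff $M,C,\pi,i+1\Vdash\phi$; $\mathtt{Y}\phi$ iff $i=0$ or $M,C,\pi,i-1\Vdash\phi$; $[\alpha]\phi$ iff $M,C^{\alpha}_i,\pi',i\Vdash\phi$ for all $\pi'\in AT(C^{\alpha}_i)$, where $C^{\alpha}_i:=C\cup\{\|\alpha\|_i\}$, $\|\alpha\|_i:=\{\pi'\in TL(M):M,C,\pi',i\Vdash\alpha\}$. Valid = true at every contextualized pointed model. The system $\mathsf{ConSHN\text{-}BT}$ (formulas range over $\Phi$; $\alpha,\beta,\gamma$ over $\Phi_{XY}$) has axioms: all instances of propositional tautologies; $\mathtt{X}\neg\phi\leftrightarrow\neg\mathtt{X}\phi$; $\mathtt{X}(\phi\land\psi)\leftrightarrow(\mathtt{X}\phi\land\mathtt{X}\psi)$; $\mathtt{X}\mathtt{Y}\phi\leftrightarrow\phi$; $\mathtt{X}[\alpha]\phi\leftrightarrow[\mathtt{X}\alpha]\mathtt{X}\phi$; $\neg\mathtt{X}\neg\top$; $\mathtt{Y}\neg\phi\leftrightarrow(\mathtt{Y}\bot\lor\neg\mathtt{Y}\phi)$; $\mathtt{Y}(\phi\land\psi)\leftrightarrow(\mathtt{Y}\phi\land\mathtt{Y}\psi)$;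 $\mathtt{Y}\mathtt{X}\phi\leftrightarrow(\mathtt{Y}\bot\lor\phi)$; $\mathtt{Y}[\alpha]\phi\leftrightarrow[\mathtt{Y}\alpha]\mathtt{Y}\phi$; $\Diamond\mathtt{Y}\bot\rightarrow(\Diamond\alpha\rightarrow\alpha)$ for $\alpha\in\Phi_{PL}$; $[\alpha](\phi\land\psi)\leftrightarrow([\alpha]\phi\land[\alpha]\psi)$; $[\alpha](\phi\lor\chi)\leftrightarrow([\alpha]\phi\lor[\alpha]\chi)$ for closed $\chi$; $[\alpha][\beta]\gamma\leftrightarrow[\alpha\land\beta]\gamma$; $[\alpha]\langle\beta\rangle\gamma\leftrightarrow([\alpha]\bot\lor\langle\alpha\land\beta\rangle\gamma)$; $[\alpha]\beta\leftrightarrow\Box(\alpha\rightarrow\beta)$; $\Box\alpha\rightarrow\alpha$. Inference rules: modus ponens; from $\phi$ infer $\mathtt{X}\phi$; from $\phi$ infer $\mathtt{Y}\phi$; from $\alpha\in\Phi_{XY}$ infer $\Box\alpha$; replacement of equivalents: from $\psi\leftrightarrow\psi'$ infer $\phi\leftrightarrow\phi'$, where $\phi'$ results from replacing the subformula $\psi$ of $\phi$ by $\psi'$. Derivable = in the smallest set containing the axioms and closed under the rules. *)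

theory Defs
  imports Main "HOL-Library.Countable" "HOL-Library.Infinite_Typeclass"
begin

section \<open>Syntax\<close>

text \<open>
  The three languages are carved out of one datatype of raw formulas, in which the argument
  of the bracket is unrestricted; the restriction to the X/Y-fragment is part of \<open>\<Phi>\<close>.
\<close>

datatype 'p fm =
    Atom 'p
  | Bot  ("\<^bold>\<bottom>")
  | Neg "'p fm"  ("\<^bold>\<not> _" [70] 70)
  | Conj "'p fm" "'p fm"  (infixr "\<^bold>\<and>" 65)
  | Next "'p fm"  ("\<^bold>X _" [70] 70)
  | Yest "'p fm"  ("\<^bold>Y _" [70] 70)
  | Ctx "'p fm" "'p fm"  ("\<^bold>[_\<^bold>] _" [0, 70] 70)

abbreviation Top :: "'p fm"  ("\<^bold>\<top>") where
  "\<^bold>\<top> \<equiv> \<^bold>\<not> \<^bold>\<bottom>"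

abbreviation Disj :: "'p fm \<Rightarrow> 'p fm \<Rightarrow> 'p fm"  (infixr "\<^bold>\<or>" 60) where
  "\<phi> \<^bold>\<or> \<psi> \<equiv> \<^bold>\<not> (\<^bold>\<not> \<phi> \<^bold>\<and> \<^bold>\<not> \<psi>)"

abbreviation Imp :: "'p fm \<Rightarrow> 'p fm \<Rightarrow> 'p fm"  (infixr "\<^bold>\<rightarrow>" 55) where
  "\<phi> \<^bold>\<rightarrow> \<psi> \<equiv> \<^bold>\<not> \<phi> \<^bold>\<or> \<psi>"

abbreviation Iff :: "'p fm \<Rightarrow> 'p fm \<Rightarrow> 'p fm"  (infix "\<^bold>\<leftrightarrow>" 50) where
  "\<phi> \<^bold>\<leftrightarrow> \<psi> \<equiv> (\<phi> \<^bold>\<rightarrow> \<psi>) \<^bold>\<and> (\<psi> \<^bold>\<rightarrow> \<phi>)"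

abbreviation CtxDual :: "'p fm \<Rightarrow> 'p fm \<Rightarrow> 'p fm"  ("\<^bold>\<langle>_\<^bold>\<rangle> _" [0, 70] 70) where
  "\<^bold>\<langle>\<alpha>\<^bold>\<rangle> \<phi> \<equiv> \<^bold>\<not> (\<^bold>[\<alpha>\<^bold>] (\<^bold>\<not> \<phi>))"

abbreviation Box :: "'p fm \<Rightarrow> 'p fm"  ("\<^bold>\<box> _" [70] 70) where
  "\<^bold>\<box> \<phi> \<equiv> \<^bold>[\<^bold>\<top>\<^bold>] \<phi>"

abbreviation Dia :: "'p fm \<Rightarrow> 'p fm"  ("\<^bold>\<diamond> _" [70] 70) where
  "\<^bold>\<diamond> \<phi> \<equiv> \<^bold>\<not> (\<^bold>\<box> (\<^bold>\<not> \<phi>))"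

primrec is_PL :: "'p fm \<Rightarrow> bool" where
  "is_PL (Atom p) = True"
| "is_PL \<^bold>\<bottom> = True"
| "is_PL (\<^bold>\<not> \<phi>) = is_PL \<phi>"
| "is_PL (\<phi> \<^bold>\<and> \<psi>) = (is_PL \<phi> \<and> is_PL \<psi>)"
| "is_PL (\<^bold>X \<phi>) = False"
| "is_PL (\<^bold>Y \<phi>) = False"
| "is_PL (\<^bold>[\<alpha>\<^bold>] \<phi>) = False"

primrec is_XY :: "'p fm \<Rightarrow> bool" where
  "is_XY (Atom p) = True"
| "is_XY \<^bold>\<bottom> = True"
| "is_XY (\<^bold>\<not> \<phi>) = is_XY \<phi>"
| "is_XY (\<phi> \<^bold>\<and> \<psi>) = (is_XY \<phi> \<and> is_XY \<psi>)"
| "is_XY (\<^bold>X \<phi>) = is_XY \<phi>"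
| "is_XY (\<^bold>Y \<phi>) = is_XY \<phi>"
| "is_XY (\<^bold>[\<alpha>\<^bold>] \<phi>) = False"

primrec is_Phi :: "'p fm \<Rightarrow> bool" where
  "is_Phi (Atom p) = True"
| "is_Phi \<^bold>\<bottom> = True"
| "is_Phi (\<^bold>\<not> \<phi>) = is_Phi \<phi>"
| "is_Phi (\<phi> \<^bold>\<and> \<psi>) = (is_Phi \<phi> \<and> is_Phi \<psi>)"
| "is_Phi (\<^bold>X \<phi>) = is_Phi \<phi>"
| "is_Phi (\<^bold>Y \<phi>) = is_Phi \<phi>"
| "is_Phi (\<^bold>[\<alpha>\<^bold>] \<phi>) = (is_XY \<alpha> \<and> is_Phi \<phi>)"

definition \<Phi>_PL :: "'p fm set" where "\<Phi>_PL = {\<phi>. is_PL \<phi>}"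
definition \<Phi>_XY :: "'p fm set" where "\<Phi>_XY = {\<phi>. is_XY \<phi>}"
definition \<Phi> :: "'p fm set" where "\<Phi> = {\<phi>. is_Phi \<phi>}"

lemma \<Phi>_PL_subset: "\<Phi>_PL \<subseteq> \<Phi>_XY"
proof
  fix \<phi> :: "'p fm" assume "\<phi> \<in> \<Phi>_PL"
  then show "\<phi> \<in> \<Phi>_XY" unfolding \<Phi>_PL_def \<Phi>_XY_def by (induction \<phi>) auto
qed

lemma \<Phi>_XY_subset: "\<Phi>_XY \<subseteq> \<Phi>"
proof
  fix \<phi> :: "'p fm" assume "\<phi> \<in> \<Phi>_XY"
  then show "\<phi> \<in> \<Phi>" unfolding \<Phi>_XY_def \<Phi>_def by (induction \<phi>) auto
qed

primrec is_closed :: "'p fm \<Rightarrow> bool" where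
  "is_closed (Atom p) = False"
| "is_closed \<^bold>\<bottom> = False"
| "is_closed (\<^bold>\<not> \<phi>) = is_closed \<phi>"
| "is_closed (\<phi> \<^bold>\<and> \<psi>) = (is_closed \<phi> \<and> is_closed \<psi>)"
| "is_closed (\<^bold>X \<phi>) = False"
| "is_closed (\<^bold>Y \<phi>) = False"
| "is_closed (\<^bold>[\<alpha>\<^bold>] \<phi>) = True"

definition \<Phi>_closed :: "'p fm set" where "\<Phi>_closed = {\<chi> \<in> \<Phi>. is_closed \<chi>}"

section \<open>Semantics\<close>

record ('w, 'p) model =
  worlds :: "'w set"
  rel :: "('w \<times> 'w) set"
  val :: "'p \<Rightarrow> 'w set"

definition is_path :: "('w, 'p) model \<Rightarrow> 'w \<Rightarrow> 'w list \<Rightarrow> 'w \<Rightarrow> bool" where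
  "is_path M x xs y \<longleftrightarrow>
     xs \<noteq> [] \<and> hd xs = x \<and> last xs = y \<and> successively (\<lambda>u v. (u, v) \<in> rel M) xs"

definition is_root :: "('w, 'p) model \<Rightarrow> 'w \<Rightarrow> bool" where
  "is_root M r \<longleftrightarrow> r \<in> worlds M \<and> (\<forall>w \<in> worlds M. \<exists>!xs. is_path M r xs w)"

definition is_model :: "('w, 'p) model \<Rightarrow> bool" where
  "is_model M \<longleftrightarrow>
     worlds M \<noteq> {} \<and>
     rel M \<subseteq> worlds M \<times> worlds M \<and>
     (\<forall>w \<in> worlds M. \<exists>v \<in> worlds M. (w, v) \<in> rel M) \<and>
     (\<exists>r. is_root M r) \<and>
     (\<forall>p. val M p \<subseteq> worlds M)"

lemma is_root_unique:
  assumes "is_root M r" "is_root M r'"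
  shows "r = r'"
proof -
  obtain xs where xs: "is_path M r xs r'"
    using assms unfolding is_root_def by blast
  obtain ys where ys: "is_path M r' ys r"
    using assms unfolding is_root_def by blast
  have "is_path M r (xs @ tl ys) r"
    using xs ys unfolding is_path_def
    by (cases ys) (auto simp: successively_append_iff successively_Cons)
  moreover have "is_path M r [r] r"
    by (simp add: is_path_def)
  ultimately have "xs @ tl ys = [r]"
    using assms(1) unfolding is_root_def by blast
  then have "xs = [r]"
    using xs by (auto simp: is_path_def append_eq_Cons_conv)
  then show ?thesis
    using xs by (simp add: is_path_def)
qed

definition TL :: "('w, 'p) model \<Rightarrow> (nat \<Rightarrow> 'w) set" where
  "TL M = {\<pi>. is_root M (\<pi> 0) \<and> (\<forall>k. (\<pi> k, \<pi> (Suc k)) \<in> rel M)}"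

definition is_context :: "('w, 'p) model \<Rightarrow> (nat \<Rightarrow> 'w) set set \<Rightarrow> bool" where
  "is_context M C \<longleftrightarrow> finite C \<and> (\<forall>R \<in> C. R \<subseteq> TL M)"

definition AT :: "('w, 'p) model \<Rightarrow> (nat \<Rightarrow> 'w) set set \<Rightarrow> (nat \<Rightarrow> 'w) set" where
  "AT M C = TL M \<inter> \<Inter>C"

primrec sat :: "('w, 'p) model \<Rightarrow> (nat \<Rightarrow> 'w) set set \<Rightarrow> (nat \<Rightarrow> 'w) \<Rightarrow> nat \<Rightarrow> 'p fm \<Rightarrow> bool" where
  "sat M C \<pi> i (Atom p) = (\<pi> i \<in> val M p)"
| "sat M C \<pi> i \<^bold>\<bottom> = False"
| "sat M C \<pi> i (\<^bold>\<not> \<phi>) = (\<not> sat M C \<pi> i \<phi>)"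
| "sat M C \<pi> i (\<phi> \<^bold>\<and> \<psi>) = (sat M C \<pi> i \<phi> \<and> sat M C \<pi> i \<psi>)"
| "sat M C \<pi> i (\<^bold>X \<phi>) = sat M C \<pi> (i + 1) \<phi>"
| "sat M C \<pi> i (\<^bold>Y \<phi>) = (i = 0 \<or> sat M C \<pi> (i - 1) \<phi>)"
| "sat M C \<pi> i (\<^bold>[\<alpha>\<^bold>] \<phi>) =
     (let C' = C \<union> {{\<pi>' \<in> TL M. sat M C \<pi>' i \<alpha>}}
      in \<forall>\<pi>' \<in> AT M C'. sat M C' \<pi>' i \<phi>)"

text \<open>
  Validity is relative to the type from which worlds are drawn. Since the relation is serial and
  paths from the root are unique, every model has infinitely many worlds; so over a finite type
  there are no models and everything is vacuously valid, and only infinite types are of interest.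
\<close>

definition valid :: "'w itself \<Rightarrow> 'p fm \<Rightarrow> bool" where
  "valid (_ :: 'w itself) \<phi> \<longleftrightarrow>
     (\<forall>(M :: ('w, 'p) model) C \<pi> i.
        is_model M \<and> is_context M C \<and> \<pi> \<in> AT M C \<longrightarrow> sat M C \<pi> i \<phi>)"

section \<open>The axiomatic system\<close>

text \<open>
  Instances of propositional tautologies: formulas true under every Boolean evaluation that
  treats atoms and formulas of the forms X, Y, bracket as opaque propositional letters.
\<close>

primrec beval :: "('p fm \<Rightarrow> bool) \<Rightarrow> 'p fm \<Rightarrow> bool" where
  "beval v (Atom p) = v (Atom p)"
| "beval v \<^bold>\<bottom> = False"
| "beval v (\<^bold>\<not> \<phi>) = (\<not> beval v \<phi>)"
| "beval v (\<phi> \<^bold>\<and> \<psi>) = (beval v \<phi> \<and> beval v \<psi>)"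
| "beval v (\<^bold>X \<phi>) = v (\<^bold>X \<phi>)"
| "beval v (\<^bold>Y \<phi>) = v (\<^bold>Y \<phi>)"
| "beval v (\<^bold>[\<alpha>\<^bold>] \<phi>) = v (\<^bold>[\<alpha>\<^bold>] \<phi>)"

definition tautology :: "'p fm \<Rightarrow> bool" where
  "tautology \<phi> \<longleftrightarrow> (\<forall>v. beval v \<phi>)"

text \<open>
  \<open>repl \<psi> \<psi>' \<phi> \<phi>'\<close>: replacing one occurrence of \<open>\<psi>\<close> in \<open>\<phi>\<close>, possibly inside a bracket,
  by \<open>\<psi>'\<close> yields \<open>\<phi>'\<close>.
\<close>

inductive repl :: "'p fm \<Rightarrow> 'p fm \<Rightarrow> 'p fm \<Rightarrow> 'p fm \<Rightarrow> bool" for \<psi> \<psi>' where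
  here: "repl \<psi> \<psi>' \<psi> \<psi>'"
| Neg: "repl \<psi> \<psi>' \<phi> \<phi>' \<Longrightarrow> repl \<psi> \<psi>' (\<^bold>\<not> \<phi>) (\<^bold>\<not> \<phi>')"
| ConjL: "repl \<psi> \<psi>' \<phi> \<phi>' \<Longrightarrow> repl \<psi> \<psi>' (\<phi> \<^bold>\<and> \<theta>) (\<phi>' \<^bold>\<and> \<theta>)"
| ConjR: "repl \<psi> \<psi>' \<phi> \<phi>' \<Longrightarrow> repl \<psi> \<psi>' (\<theta> \<^bold>\<and> \<phi>) (\<theta> \<^bold>\<and> \<phi>')"
| Next: "repl \<psi> \<psi>' \<phi> \<phi>' \<Longrightarrow> repl \<psi> \<psi>' (\<^bold>X \<phi>) (\<^bold>X \<phi>')"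
| Yest: "repl \<psi> \<psi>' \<phi> \<phi>' \<Longrightarrow> repl \<psi> \<psi>' (\<^bold>Y \<phi>) (\<^bold>Y \<phi>')"
| CtxL: "repl \<psi> \<psi>' \<alpha> \<alpha>' \<Longrightarrow> repl \<psi> \<psi>' (\<^bold>[\<alpha>\<^bold>] \<theta>) (\<^bold>[\<alpha>'\<^bold>] \<theta>)"
| CtxR: "repl \<psi> \<psi>' \<phi> \<phi>' \<Longrightarrow> repl \<psi> \<psi>' (\<^bold>[\<alpha>\<^bold>] \<phi>) (\<^bold>[\<alpha>\<^bold>] \<phi>')"

inductive derivable :: "'p fm \<Rightarrow> bool" where
  Taut: "\<lbrakk>\<phi> \<in> \<Phi>; tautology \<phi>\<rbrakk> \<Longrightarrow> derivable \<phi>"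
| X_Neg: "\<phi> \<in> \<Phi> \<Longrightarrow> derivable (\<^bold>X \<^bold>\<not> \<phi> \<^bold>\<leftrightarrow> \<^bold>\<not> \<^bold>X \<phi>)"
| X_Conj: "\<lbrakk>\<phi> \<in> \<Phi>; \<psi> \<in> \<Phi>\<rbrakk> \<Longrightarrow> derivable (\<^bold>X (\<phi> \<^bold>\<and> \<psi>) \<^bold>\<leftrightarrow> (\<^bold>X \<phi> \<^bold>\<and> \<^bold>X \<psi>))"
| X_Y: "\<phi> \<in> \<Phi> \<Longrightarrow> derivable (\<^bold>X \<^bold>Y \<phi> \<^bold>\<leftrightarrow> \<phi>)"
| X_Ctx: "\<lbrakk>\<alpha> \<in> \<Phi>_XY; \<phi> \<in> \<Phi>\<rbrakk> \<Longrightarrow> derivable (\<^bold>X \<^bold>[\<alpha>\<^bold>] \<phi> \<^bold>\<leftrightarrow> \<^bold>[\<^bold>X \<alpha>\<^bold>] \<^bold>X \<phi>)"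
| X_Ser: "derivable (\<^bold>\<not> \<^bold>X \<^bold>\<not> \<^bold>\<top>)"
| Y_Neg: "\<phi> \<in> \<Phi> \<Longrightarrow> derivable (\<^bold>Y \<^bold>\<not> \<phi> \<^bold>\<leftrightarrow> (\<^bold>Y \<^bold>\<bottom> \<^bold>\<or> \<^bold>\<not> \<^bold>Y \<phi>))"
| Y_Conj: "\<lbrakk>\<phi> \<in> \<Phi>; \<psi> \<in> \<Phi>\<rbrakk> \<Longrightarrow> derivable (\<^bold>Y (\<phi> \<^bold>\<and> \<psi>) \<^bold>\<leftrightarrow> (\<^bold>Y \<phi> \<^bold>\<and> \<^bold>Y \<psi>))"
| Y_X: "\<phi> \<in> \<Phi> \<Longrightarrow> derivable (\<^bold>Y \<^bold>X \<phi> \<^bold>\<leftrightarrow> (\<^bold>Y \<^bold>\<bottom> \<^bold>\<or> \<phi>))"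
| Y_Ctx: "\<lbrakk>\<alpha> \<in> \<Phi>_XY; \<phi> \<in> \<Phi>\<rbrakk> \<Longrightarrow> derivable (\<^bold>Y \<^bold>[\<alpha>\<^bold>] \<phi> \<^bold>\<leftrightarrow> \<^bold>[\<^bold>Y \<alpha>\<^bold>] \<^bold>Y \<phi>)"
| Root: "\<alpha> \<in> \<Phi>_PL \<Longrightarrow> derivable (\<^bold>\<diamond> \<^bold>Y \<^bold>\<bottom> \<^bold>\<rightarrow> (\<^bold>\<diamond> \<alpha> \<^bold>\<rightarrow> \<alpha>))"
| Ctx_Conj: "\<lbrakk>\<alpha> \<in> \<Phi>_XY; \<phi> \<in> \<Phi>; \<psi> \<in> \<Phi>\<rbrakk> \<Longrightarrow>
    derivable (\<^bold>[\<alpha>\<^bold>] (\<phi> \<^bold>\<and> \<psi>) \<^bold>\<leftrightarrow> (\<^bold>[\<alpha>\<^bold>] \<phi> \<^bold>\<and> \<^bold>[\<alpha>\<^bold>] \<psi>))"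
| Ctx_Disj: "\<lbrakk>\<alpha> \<in> \<Phi>_XY; \<phi> \<in> \<Phi>; \<chi> \<in> \<Phi>_closed\<rbrakk> \<Longrightarrow>
    derivable (\<^bold>[\<alpha>\<^bold>] (\<phi> \<^bold>\<or> \<chi>) \<^bold>\<leftrightarrow> (\<^bold>[\<alpha>\<^bold>] \<phi> \<^bold>\<or> \<^bold>[\<alpha>\<^bold>] \<chi>))"
| Ctx_Ctx: "\<lbrakk>\<alpha> \<in> \<Phi>_XY; \<beta> \<in> \<Phi>_XY; \<gamma> \<in> \<Phi>_XY\<rbrakk> \<Longrightarrow>
    derivable (\<^bold>[\<alpha>\<^bold>] \<^bold>[\<beta>\<^bold>] \<gamma> \<^bold>\<leftrightarrow> \<^bold>[\<alpha> \<^bold>\<and> \<beta>\<^bold>] \<gamma>)"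
| Ctx_CtxDual: "\<lbrakk>\<alpha> \<in> \<Phi>_XY; \<beta> \<in> \<Phi>_XY; \<gamma> \<in> \<Phi>_XY\<rbrakk> \<Longrightarrow>
    derivable (\<^bold>[\<alpha>\<^bold>] \<^bold>\<langle>\<beta>\<^bold>\<rangle> \<gamma> \<^bold>\<leftrightarrow> (\<^bold>[\<alpha>\<^bold>] \<^bold>\<bottom> \<^bold>\<or> \<^bold>\<langle>\<alpha> \<^bold>\<and> \<beta>\<^bold>\<rangle> \<gamma>))"
| Ctx_Box: "\<lbrakk>\<alpha> \<in> \<Phi>_XY; \<beta> \<in> \<Phi>_XY\<rbrakk> \<Longrightarrow> derivable (\<^bold>[\<alpha>\<^bold>] \<beta> \<^bold>\<leftrightarrow> \<^bold>\<box> (\<alpha> \<^bold>\<rightarrow> \<beta>))"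
| Box_T: "\<alpha> \<in> \<Phi>_XY \<Longrightarrow> derivable (\<^bold>\<box> \<alpha> \<^bold>\<rightarrow> \<alpha>)"
| MP: "\<lbrakk>derivable (\<phi> \<^bold>\<rightarrow> \<psi>); derivable \<phi>\<rbrakk> \<Longrightarrow> derivable \<psi>"
| X_Nec: "derivable \<phi> \<Longrightarrow> derivable (\<^bold>X \<phi>)"
| Y_Nec: "derivable \<phi> \<Longrightarrow> derivable (\<^bold>Y \<phi>)"
| Box_Nec: "\<lbrakk>\<alpha> \<in> \<Phi>_XY; derivable \<alpha>\<rbrakk> \<Longrightarrow> derivable (\<^bold>\<box> \<alpha>)"
| RE: "\<lbrakk>derivable (\<psi> \<^bold>\<leftrightarrow> \<psi>'); \<phi> \<in> \<Phi>; \<phi>' \<in> \<Phi>; repl \<psi> \<psi>' \<phi> \<phi>'\<rbrakk> \<Longrightarrow>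
    derivable (\<phi> \<^bold>\<leftrightarrow> \<phi>')"

end

theory Submission
  imports Defs "HOL-Library.Countable_Set"
begin

text \<open>
  Completeness. The bracket axioms reduce every formula to a Boolean combination of
  X/Y-formulas and formulas \<open>\<box>\<alpha>\<close> with \<open>\<alpha>\<close> an X/Y-formula. On this fragment the box is an
  S5 modality, so the accessible valuations of an S5 canonical model serve as timelines,
  the atom \<open>p\<close> holding at time \<open>n\<close> iff the valuation satisfies \<open>X\<^sup>n p\<close>. The obstacle is that a
  canonical valuation may lie infinitely far from the root. It is removed by the observation
  that \<open>\<phi>\<close> is derivable as soon as \<open>X\<phi>\<close> and \<open>Y\<bottom> \<rightarrow> \<phi>\<close> are. So an underivable \<open>\<phi>\<close> yields some
  \<open>k\<close> such that either \<open>Y\<bottom> \<rightarrow> X\<^sup>k \<phi>\<close> is underivable, and time starts here, or \<open>X\<^sup>k \<phi>\<close> is underivable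
  and \<open>k\<close> bounds the nesting of \<open>Y\<close> in \<open>\<phi>\<close>, so that \<open>\<phi>\<close> evaluated \<open>k\<close> steps later cannot
  reach the root.
\<close>

section \<open>Soundness\<close>

lemma mem_\<Phi>_iff [simp]: "\<phi> \<in> \<Phi> \<longleftrightarrow> is_Phi \<phi>"
  by (simp add: \<Phi>_def)

lemma mem_\<Phi>_XY_iff [simp]: "\<phi> \<in> \<Phi>_XY \<longleftrightarrow> is_XY \<phi>"
  by (simp add: \<Phi>_XY_def)

lemma mem_\<Phi>_PL_iff [simp]: "\<phi> \<in> \<Phi>_PL \<longleftrightarrow> is_PL \<phi>"
  by (simp add: \<Phi>_PL_def)

lemma mem_\<Phi>_closed_iff [simp]: "\<phi> \<in> \<Phi>_closed \<longleftrightarrow> is_Phi \<phi> \<and> is_closed \<phi>"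
  by (simp add: \<Phi>_closed_def)

lemma is_PL_imp_is_XY [simp]: "is_PL \<phi> \<Longrightarrow> is_XY \<phi>"
  using \<Phi>_PL_subset by auto

lemma is_XY_imp_is_Phi [simp]: "is_XY \<phi> \<Longrightarrow> is_Phi \<phi>"
  using \<Phi>_XY_subset by auto

lemma derivable_is_Phi: "derivable \<phi> \<Longrightarrow> is_Phi \<phi>"
  by (induction rule: derivable.induct) auto

text \<open>Only the bracket clause of \<open>sat\<close> reads the context, and X/Y-formulas
  contain no bracket.\<close>

lemma sat_XY_context_irrelevant: "is_XY \<alpha> \<Longrightarrow> sat M C \<pi> i \<alpha> \<longleftrightarrow> sat M C' \<pi> i \<alpha>"
  by (induction \<alpha> arbitrary: i) auto

lemma sat_PL_state: "is_PL \<alpha> \<Longrightarrow> \<pi> i = \<pi>' i \<Longrightarrow> sat M C \<pi> i \<alpha> \<longleftrightarrow> sat M C' \<pi>' i \<alpha>"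
  by (induction \<alpha>) auto

text \<open>A bracket quantifies over every timeline of the updated context and forgets the current
  one; Boolean combinations inherit this. Soundness of \<open>Ctx_Disj\<close> rests on it.\<close>

lemma sat_closed_timeline_irrelevant:
  "is_closed \<chi> \<Longrightarrow> sat M C \<pi> i \<chi> \<longleftrightarrow> sat M C \<pi>' i \<chi>"
  by (induction \<chi>) auto

lemma sat_beval: "sat M C \<pi> i \<phi> \<longleftrightarrow> beval (sat M C \<pi> i) \<phi>"
  by (induction \<phi>) auto

section \<open>Context update by a bracket\<close>

definition upd :: "('w, 'p) model \<Rightarrow> (nat \<Rightarrow> 'w) set set \<Rightarrow> nat \<Rightarrow> 'p fm \<Rightarrow> (nat \<Rightarrow> 'w) set set"
  where "upd M C i \<alpha> = C \<union> {{\<pi> \<in> TL M. sat M C \<pi> i \<alpha>}}"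

lemma sat_Ctx: "sat M C \<pi> i (\<^bold>[\<alpha>\<^bold>] \<phi>) \<longleftrightarrow> (\<forall>\<pi>' \<in> AT M (upd M C i \<alpha>). sat M (upd M C i \<alpha>) \<pi>' i \<phi>)"
  by (simp add: upd_def Let_def)

lemma AT_upd: "AT M (upd M C i \<alpha>) = {\<pi> \<in> AT M C. sat M C \<pi> i \<alpha>}"
  by (auto simp: AT_def upd_def)

lemma is_context_upd [simp]: "is_context M C \<Longrightarrow> is_context M (upd M C i \<alpha>)"
  by (auto simp: is_context_def upd_def)

lemma sat_Ctx_XY:
  "is_XY \<beta> \<Longrightarrow> sat M C \<pi> i (\<^bold>[\<alpha>\<^bold>] \<beta>) \<longleftrightarrow> (\<forall>\<pi>' \<in> AT M C. sat M C \<pi>' i \<alpha> \<longrightarrow> sat M C \<pi>' i \<beta>)"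
  unfolding sat_Ctx AT_upd using sat_XY_context_irrelevant by blast

text \<open>Soundness of replacement. The equivalence has to be available in every context, because
  the body of a bracket is evaluated in the updated one.\<close>

lemma sat_repl:
  assumes "repl \<psi> \<psi>' \<phi> \<phi>'"
    and eq: "\<And>C \<pi> i. is_context M C \<Longrightarrow> \<pi> \<in> AT M C \<Longrightarrow> sat M C \<pi> i \<psi> \<longleftrightarrow> sat M C \<pi> i \<psi>'"
    and "is_Phi \<phi>" "is_Phi \<phi>'" "is_context M C" "\<pi> \<in> AT M C"
  shows "sat M C \<pi> i \<phi> \<longleftrightarrow> sat M C \<pi> i \<phi>'"
  using assms(1,3-)
proof (induction arbitrary: C \<pi> i rule: repl.induct)
  case (CtxL \<alpha> \<alpha>' \<theta>)
  \<comment> \<open>\<open>eq\<close> speaks of timelines in \<open>AT M C\<close>, whereas the set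
    added by a bracket is cut out of all of \<open>TL M\<close>. The empty context has
    \<open>AT\<close> equal to \<open>TL M\<close>, and bracket arguments, being X/Y-formulas, do
    not see the change of context.\<close>
  have "sat M C \<pi>' i \<alpha> \<longleftrightarrow> sat M C \<pi>' i \<alpha>'" if "\<pi>' \<in> TL M" for \<pi>'
  proof -
    have "sat M {} \<pi>' i \<alpha> \<longleftrightarrow> sat M {} \<pi>' i \<alpha>'"
      using CtxL that by (intro CtxL.IH) (auto simp: is_context_def AT_def)
    then show ?thesis
      using CtxL.prems sat_XY_context_irrelevant by (metis is_Phi.simps(7))
  qed
  then have "upd M C i \<alpha> = upd M C i \<alpha>'"
    by (auto simp: upd_def)
  then show ?case
    unfolding sat_Ctx by simp
next
  case (CtxR \<phi> \<phi>' \<alpha>)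
  then have "sat M (upd M C i \<alpha>) \<pi>' i \<phi> \<longleftrightarrow> sat M (upd M C i \<alpha>) \<pi>' i \<phi>'"
    if "\<pi>' \<in> AT M (upd M C i \<alpha>)" for \<pi>'
    using that by (auto intro!: CtxR.IH)
  then show ?case
    unfolding sat_Ctx by blast
qed (auto simp: eq)

theorem soundness:
  assumes "derivable \<phi>" "is_model M" "is_context M C" "\<pi> \<in> AT M C"
  shows "sat M C \<pi> i \<phi>"
  using assms(1,3,4)
proof (induction arbitrary: C \<pi> i rule: derivable.induct)
  case (Taut \<phi>)
  then show ?case
    using sat_beval tautology_def by metis
next
  case (X_Ctx \<alpha> \<phi>)
  have "upd M C (i + 1) \<alpha> = upd M C i (\<^bold>X \<alpha>)"
    by (simp add: upd_def)
  then show ?case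
    by (auto simp add: sat_Ctx simp del: sat.simps(7))
next
  case (Y_Ctx \<alpha> \<phi>)
  have "i \<noteq> 0 \<Longrightarrow> upd M C (i - 1) \<alpha> = upd M C i (\<^bold>Y \<alpha>)"
    by (simp add: upd_def)
  then show ?case
    by (auto simp add: sat_Ctx simp del: sat.simps(7))
next
  case (Root \<alpha>)
  \<comment> \<open>All timelines start at the same root, so at time 0 a propositional formula has
    the same truth value on each. At later times the antecedent of the axiom is false.\<close>
  have "\<pi>' 0 = \<pi> 0" if "\<pi>' \<in> AT M C" for \<pi>'
    using that Root.prems(2) by (auto simp: AT_def TL_def intro: is_root_unique)
  then have "sat M C \<pi>' 0 \<alpha> \<longleftrightarrow> sat M C \<pi> 0 \<alpha>" if "\<pi>' \<in> AT M C" for \<pi>'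
    using that Root.hyps sat_PL_state by (metis mem_\<Phi>_PL_iff)
  then show ?case
    using Root.hyps by (cases i) (simp_all add: sat_Ctx_XY del: sat.simps(7))
next
  case (Ctx_Conj \<alpha> \<phi> \<psi>)
  then show ?case
    by (auto simp add: sat_Ctx simp del: sat.simps(7))
next
  case (Ctx_Disj \<alpha> \<phi> \<chi>)
  then have "sat M C' \<pi>1 i \<chi> \<longleftrightarrow> sat M C' \<pi>2 i \<chi>" for C' \<pi>1 \<pi>2
    by (intro sat_closed_timeline_irrelevant) simp
  then show ?case
    by (simp add: sat_Ctx del: sat.simps(7)) blast
next
  case (Ctx_Ctx \<alpha> \<beta> \<gamma>)
  then have "sat M (upd M C i \<alpha>) \<pi>' i \<delta> \<longleftrightarrow> sat M C \<pi>' i \<delta>" if "\<delta> \<in> {\<beta>, \<gamma>}" for \<pi>' \<delta>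
    using that by (intro sat_XY_context_irrelevant) auto
  then show ?case
    using Ctx_Ctx
    by (auto simp add: sat_Ctx[of _ _ _ _ _ "\<^bold>[\<beta>\<^bold>] \<gamma>"] sat_Ctx_XY AT_upd simp del: sat.simps(7))
next
  case (Ctx_CtxDual \<alpha> \<beta> \<gamma>)
  then have "sat M (upd M C i \<alpha>) \<pi>' i \<delta> \<longleftrightarrow> sat M C \<pi>' i \<delta>" if "\<delta> \<in> {\<beta>, \<gamma>}" for \<pi>' \<delta>
    using that by (intro sat_XY_context_irrelevant) auto
  then show ?case
    using Ctx_CtxDual
    by (auto simp add: sat_Ctx[of _ _ _ _ _ "\<^bold>\<langle>\<beta>\<^bold>\<rangle> \<gamma>"] sat_Ctx_XY AT_upd simp del: sat.simps(7))
next
  case (Ctx_Box \<alpha> \<beta>)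
  then show ?case
    by (auto simp add: sat_Ctx_XY simp del: sat.simps(7))
next
  case (Box_T \<alpha>)
  then show ?case
    by (auto simp add: sat_Ctx_XY simp del: sat.simps(7))
next
  case (Box_Nec \<alpha>)
  then show ?case
    by (auto simp add: sat_Ctx_XY simp del: sat.simps(7))
next
  case (RE \<psi> \<psi>' \<phi> \<phi>')
  have eq: "sat M C \<pi> i \<psi> \<longleftrightarrow> sat M C \<pi> i \<psi>'" if "is_context M C" "\<pi> \<in> AT M C" for C \<pi> i
    using RE.IH[OF that] by auto
  have "sat M C \<pi> i \<phi> \<longleftrightarrow> sat M C \<pi> i \<phi>'"
    using RE.hyps(2,3) by (intro sat_repl[OF RE.hyps(4) eq] RE.prems) simp_all
  then show ?case
    by auto
next
  case (MP \<phi> \<psi>)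
  then show ?case
    by simp
next
  case (Y_Nec \<phi>)
  then show ?case
    by simp
qed auto

section \<open>Canonical valuations\<close>

text \<open>Such a valuation plays the role of a maximal consistent set: X-, Y- and bracket formulas
  count as letters, and the theorems constrain their values.\<close>

definition admissible :: "('p fm \<Rightarrow> bool) \<Rightarrow> bool" where
  "admissible v \<longleftrightarrow> (\<forall>\<phi>. derivable \<phi> \<longrightarrow> beval v \<phi>)"

lemma admissibleD: "derivable \<phi> \<Longrightarrow> admissible v \<Longrightarrow> beval v \<phi>"
  by (simp add: admissible_def)

text \<open>A maximal set among the supersets of \<open>T\<close> that omit \<open>\<psi>\<close>
  and are closed under modus ponens decides every formula of \<open>\<Phi>\<close>, so membership in
  it is a Boolean valuation. Stating this for any closed \<open>T\<close> covers both the set of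
  theorems and the consequences of boxed formulas.\<close>

lemma lindenbaum:
  fixes T :: "'p fm set"
  assumes taut: "\<And>\<phi>. is_Phi \<phi> \<Longrightarrow> tautology \<phi> \<Longrightarrow> \<phi> \<in> T"
    and mp: "\<And>\<phi> \<psi>. is_Phi \<phi> \<Longrightarrow> is_Phi \<psi> \<Longrightarrow> (\<phi> \<^bold>\<rightarrow> \<psi>) \<in> T \<Longrightarrow> \<phi> \<in> T \<Longrightarrow> \<psi> \<in> T"
    and \<psi>: "is_Phi \<psi>" "\<psi> \<notin> T"
  obtains v where "\<And>\<phi>. is_Phi \<phi> \<Longrightarrow> \<phi> \<in> T \<Longrightarrow> beval v \<phi>" "\<not> beval v \<psi>"
proof -
  define A where "A = {S. T \<subseteq> S \<and> \<psi> \<notin> S \<and>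
    (\<forall>\<phi> \<theta>. is_Phi \<phi> \<longrightarrow> is_Phi \<theta> \<longrightarrow> (\<phi> \<^bold>\<rightarrow> \<theta>) \<in> S \<longrightarrow> \<phi> \<in> S \<longrightarrow> \<theta> \<in> S)}"
  have "T \<in> A"
    unfolding A_def using mp \<psi> by blast
  \<comment> \<open>The two premises of a modus ponens lie in a common member of the chain, so the
    union stays closed.\<close>
  have "\<Union>\<C> \<in> A" if "\<C> \<noteq> {}" "subset.chain A \<C>" for \<C>
  proof -
    have sub: "\<C> \<subseteq> A" and lin: "\<And>X Y. X \<in> \<C> \<Longrightarrow> Y \<in> \<C> \<Longrightarrow> X \<subseteq> Y \<or> Y \<subseteq> X"
      using that(2) unfolding subset.chain_def by auto
    have "\<theta> \<in> \<Union>\<C>" if h: "is_Phi \<phi>" "is_Phi \<theta>" "(\<phi> \<^bold>\<rightarrow> \<theta>) \<in> \<Union>\<C>" "\<phi> \<in> \<Union>\<C>" for \<phi> \<theta>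
    proof -
      obtain X Y where "X \<in> \<C>" "Y \<in> \<C>" "(\<phi> \<^bold>\<rightarrow> \<theta>) \<in> X" "\<phi> \<in> Y"
        using h by blast
      then obtain Z where "Z \<in> \<C>" "(\<phi> \<^bold>\<rightarrow> \<theta>) \<in> Z" "\<phi> \<in> Z"
        using lin by (metis subsetD)
      then show ?thesis
        using sub h(1,2) unfolding A_def by blast
    qed
    then show ?thesis
      using that(1) sub unfolding A_def by blast
  qed
  then obtain S where S: "S \<in> A" and max: "\<And>X. X \<in> A \<Longrightarrow> S \<subseteq> X \<Longrightarrow> X = S"
    using subset_Zorn_nonempty[of A] \<open>T \<in> A\<close> by blast
  have TS: "T \<subseteq> S" and \<psi>S: "\<psi> \<notin> S"
    and mpS: "\<And>\<phi> \<theta>. is_Phi \<phi> \<Longrightarrow> is_Phi \<theta> \<Longrightarrow> (\<phi> \<^bold>\<rightarrow> \<theta>) \<in> S \<Longrightarrow> \<phi> \<in> S \<Longrightarrow> \<theta> \<in> S"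
    using S unfolding A_def by blast+
  have tautS: "\<phi> \<in> S" if "is_Phi \<phi>" "\<And>v. beval v \<phi>" for \<phi>
    using that taut TS unfolding tautology_def by blast
  have cons1: "\<theta> \<in> S" if "\<phi> \<in> S" "is_Phi \<phi>" "is_Phi \<theta>" "\<And>v. beval v \<phi> \<Longrightarrow> beval v \<theta>" for \<phi> \<theta>
    using that tautS by (intro mpS[of \<phi> \<theta>]) auto
  have cons2: "\<theta> \<in> S" if "\<phi>1 \<in> S" "\<phi>2 \<in> S" "is_Phi \<phi>1" "is_Phi \<phi>2" "is_Phi \<theta>"
    "\<And>v. beval v \<phi>1 \<Longrightarrow> beval v \<phi>2 \<Longrightarrow> beval v \<theta>" for \<phi>1 \<phi>2 \<theta>
    using that cons1[of \<phi>1 "\<phi>2 \<^bold>\<rightarrow> \<theta>"] by (intro mpS[of \<phi>2 \<theta>]) auto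
  \<comment> \<open>By maximality, adding \<open>\<phi>\<close> and closing up must produce
    \<open>\<psi>\<close>. The closure is explicit: besides \<open>S\<close> it contains whatever
    \<open>\<phi>\<close> implies according to \<open>S\<close>.\<close>
  have out: "(\<phi> \<^bold>\<rightarrow> \<psi>) \<in> S" if \<phi>: "is_Phi \<phi>" "\<phi> \<notin> S" for \<phi>
  proof (rule ccontr)
    assume not: "(\<phi> \<^bold>\<rightarrow> \<psi>) \<notin> S"
    define S' where "S' = S \<union> {\<theta>. is_Phi \<theta> \<and> (\<phi> \<^bold>\<rightarrow> \<theta>) \<in> S}"
    have imp: "(\<phi> \<^bold>\<rightarrow> \<theta>) \<in> S" if "\<theta> \<in> S'" "is_Phi \<theta>" for \<theta>
      using that \<phi> cons1[of \<theta> "\<phi> \<^bold>\<rightarrow> \<theta>"] unfolding S'_def by auto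
    have "\<theta> \<in> S'" if h: "is_Phi \<xi>" "is_Phi \<theta>" "(\<xi> \<^bold>\<rightarrow> \<theta>) \<in> S'" "\<xi> \<in> S'" for \<xi> \<theta>
    proof -
      have "(\<phi> \<^bold>\<rightarrow> (\<xi> \<^bold>\<rightarrow> \<theta>)) \<in> S" "(\<phi> \<^bold>\<rightarrow> \<xi>) \<in> S"
        using h by (simp_all add: imp)
      then have "(\<phi> \<^bold>\<rightarrow> \<theta>) \<in> S"
        by (rule cons2) (use h(1,2) \<phi>(1) in auto)
      then show ?thesis
        using h(2) unfolding S'_def by simp
    qed
    then have "S' \<in> A"
      using TS \<psi>S not unfolding A_def S'_def by blast
    then have "S' = S"
      using max unfolding S'_def by blast
    moreover have "\<phi> \<in> S'"
      using \<phi> tautS[of "\<phi> \<^bold>\<rightarrow> \<phi>"] unfolding S'_def by auto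
    ultimately show False
      using \<phi> by simp
  qed
  have "beval (\<lambda>\<phi>. \<phi> \<in> S) \<phi> \<longleftrightarrow> \<phi> \<in> S" if "is_Phi \<phi>" for \<phi>
    using that
  proof (induction \<phi>)
    case Bot
    then show ?case
      using cons1[of Bot \<psi>] \<psi> \<psi>S by auto
  next
    case (Neg \<phi>)
    have "\<not> (\<phi> \<in> S \<and> (\<^bold>\<not> \<phi>) \<in> S)"
      using cons2[of \<phi> "\<^bold>\<not> \<phi>" \<psi>] \<psi> \<psi>S Neg.prems by auto
    \<comment> \<open>If both were missing, \<open>out\<close> would make each of them imply
      \<open>\<psi>\<close> in \<open>S\<close>, and then \<open>\<psi>\<close> itself would be
      there.\<close>
    moreover have "\<phi> \<in> S \<or> (\<^bold>\<not> \<phi>) \<in> S"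
      using cons2[of "\<phi> \<^bold>\<rightarrow> \<psi>" "\<^bold>\<not> \<phi> \<^bold>\<rightarrow> \<psi>" \<psi>] out[of \<phi>] out[of "\<^bold>\<not> \<phi>"] \<psi> \<psi>S Neg.prems by auto
    ultimately show ?case
      using Neg by auto
  next
    case (Conj \<phi>1 \<phi>2)
    then show ?case
      using cons1[of "\<phi>1 \<^bold>\<and> \<phi>2" \<phi>1] cons1[of "\<phi>1 \<^bold>\<and> \<phi>2" \<phi>2] cons2[of \<phi>1 \<phi>2 "\<phi>1 \<^bold>\<and> \<phi>2"] by auto
  qed auto
  then show thesis
    using that[of "\<lambda>\<phi>. \<phi> \<in> S"] TS \<psi> \<psi>S by blast
qed

text \<open>Boolean reasoning inside the calculus thereby becomes reasoning about
  \<open>beval\<close>, which automation can do.\<close>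

lemma derivable_iff_admissible:
  assumes "is_Phi \<psi>"
  shows "derivable \<psi> \<longleftrightarrow> (\<forall>v. admissible v \<longrightarrow> beval v \<psi>)"
proof
  assume adm: "\<forall>v. admissible v \<longrightarrow> beval v \<psi>"
  show "derivable \<psi>"
  proof (rule ccontr)
    assume "\<not> derivable \<psi>"
    obtain v where "\<And>\<phi>. is_Phi \<phi> \<Longrightarrow> \<phi> \<in> Collect derivable \<Longrightarrow> beval v \<phi>" "\<not> beval v \<psi>"
    proof (rule lindenbaum)
      show "\<phi> \<in> Collect derivable" if "is_Phi \<phi>" "tautology \<phi>" for \<phi>
        using that Taut by simp
      show "\<theta> \<in> Collect derivable"
        if "(\<phi> \<^bold>\<rightarrow> \<theta>) \<in> Collect derivable" "\<phi> \<in> Collect derivable" for \<phi> \<theta>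
        using that MP by blast
      show "\<psi> \<notin> Collect derivable"
        using \<open>\<not> derivable \<psi>\<close> by simp
    qed (use assms in auto)
    then show False
      using adm derivable_is_Phi unfolding admissible_def by blast
  qed
qed (auto simp: admissible_def)

section \<open>Provable equivalence and basic theorems\<close>

definition eqv :: "'p fm \<Rightarrow> 'p fm \<Rightarrow> bool"  (infix "\<approx>" 45) where
  "\<phi> \<approx> \<psi> \<longleftrightarrow> derivable (\<phi> \<^bold>\<leftrightarrow> \<psi>)"

lemma eqv_is_Phi: "\<phi> \<approx> \<psi> \<Longrightarrow> is_Phi \<phi> \<and> is_Phi \<psi>"
  unfolding eqv_def by (drule derivable_is_Phi) auto

lemma eqv_iff:
  "\<phi> \<approx> \<psi> \<longleftrightarrow> is_Phi \<phi> \<and> is_Phi \<psi> \<and> (\<forall>v. admissible v \<longrightarrow> beval v \<phi> = beval v \<psi>)"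
proof (cases "is_Phi \<phi> \<and> is_Phi \<psi>")
  case True
  then have "\<phi> \<approx> \<psi> \<longleftrightarrow> (\<forall>v. admissible v \<longrightarrow> beval v (\<phi> \<^bold>\<leftrightarrow> \<psi>))"
    unfolding eqv_def by (intro derivable_iff_admissible) simp
  also have "\<dots> \<longleftrightarrow> (\<forall>v. admissible v \<longrightarrow> beval v \<phi> = beval v \<psi>)"
    by auto
  finally show ?thesis
    using True by simp
qed (use eqv_is_Phi in blast)

lemma eqv_trans [trans]: "\<phi> \<approx> \<psi> \<Longrightarrow> \<psi> \<approx> \<theta> \<Longrightarrow> \<phi> \<approx> \<theta>"
  by (auto simp: eqv_iff)

lemma eqv_sym: "\<phi> \<approx> \<psi> \<Longrightarrow> \<psi> \<approx> \<phi>"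
  by (auto simp: eqv_iff)

lemma eqv_beval: "\<phi> \<approx> \<psi> \<Longrightarrow> admissible v \<Longrightarrow> beval v \<phi> = beval v \<psi>"
  by (auto simp: eqv_iff)

lemma eqv_Neg: "\<phi> \<approx> \<phi>' \<Longrightarrow> \<^bold>\<not> \<phi> \<approx> \<^bold>\<not> \<phi>'"
  by (auto simp: eqv_iff)

lemma eqv_Conj: "\<phi> \<approx> \<phi>' \<Longrightarrow> \<psi> \<approx> \<psi>' \<Longrightarrow> \<phi> \<^bold>\<and> \<psi> \<approx> \<phi>' \<^bold>\<and> \<psi>'"
  by (auto simp: eqv_iff)

text \<open>For the non-Boolean connectives congruence comes from the rule \<open>RE\<close>, as
  valuations treat such formulas as letters.\<close>

lemma eqv_Next:
  assumes "\<phi> \<approx> \<phi>'"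
  shows "\<^bold>X \<phi> \<approx> \<^bold>X \<phi>'"
  using assms eqv_is_Phi[OF assms(1)] unfolding eqv_def
  by (intro RE[OF _ _ _ repl.Next[OF repl.here]]) simp_all

lemma eqv_Yest:
  assumes "\<phi> \<approx> \<phi>'"
  shows "\<^bold>Y \<phi> \<approx> \<^bold>Y \<phi>'"
  using assms eqv_is_Phi[OF assms(1)] unfolding eqv_def
  by (intro RE[OF _ _ _ repl.Yest[OF repl.here]]) simp_all

lemma eqv_Ctx:
  assumes "is_XY \<alpha>" "\<phi> \<approx> \<phi>'"
  shows "\<^bold>[\<alpha>\<^bold>] \<phi> \<approx> \<^bold>[\<alpha>\<^bold>] \<phi>'"
  using assms eqv_is_Phi[OF assms(2)] unfolding eqv_def
  by (intro RE[OF _ _ _ repl.CtxR[OF repl.here]]) simp_all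

lemma Box_Conj_eqv:
  "is_XY \<alpha> \<Longrightarrow> is_XY \<beta> \<Longrightarrow> \<^bold>\<box> (\<alpha> \<^bold>\<and> \<beta>) \<approx> \<^bold>\<box> \<alpha> \<^bold>\<and> \<^bold>\<box> \<beta>"
  unfolding eqv_def by (intro Ctx_Conj) auto

text \<open>The premise makes \<open>\<alpha>\<close> equivalent to its conjunction with
  \<open>\<beta>\<close>; replacement carries this under the box, which distributes over the
  conjunction.\<close>

lemma Box_mono:
  assumes "is_XY \<alpha>" "is_XY \<beta>" "derivable (\<alpha> \<^bold>\<rightarrow> \<beta>)" "admissible v" "beval v (\<^bold>\<box> \<alpha>)"
  shows "beval v (\<^bold>\<box> \<beta>)"
proof -
  have "\<alpha> \<approx> \<alpha> \<^bold>\<and> \<beta>"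
    using admissibleD[OF assms(3)] assms(1,2) by (auto simp: eqv_iff)
  then have "\<^bold>\<box> \<alpha> \<approx> \<^bold>\<box> (\<alpha> \<^bold>\<and> \<beta>)"
    by (simp add: eqv_Ctx)
  also have "\<dots> \<approx> \<^bold>\<box> \<alpha> \<^bold>\<and> \<^bold>\<box> \<beta>"
    using assms by (simp add: Box_Conj_eqv)
  finally show ?thesis
    using assms(5) by (auto dest: eqv_beval[OF _ assms(4)])
qed

text \<open>The same trick as for \<open>Box_mono\<close>, with \<open>Bot\<close> equivalent to its
  conjunction with \<open>\<phi>\<close>.\<close>

lemma Yest_Bot_imp_Yest:
  assumes "is_Phi \<phi>" "admissible v" "beval v (\<^bold>Y \<^bold>\<bottom>)"
  shows "beval v (\<^bold>Y \<phi>)"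
proof -
  have "\<^bold>Y \<^bold>\<bottom> \<approx> \<^bold>Y (\<^bold>\<bottom> \<^bold>\<and> \<phi>)"
    using assms(1) by (intro eqv_Yest) (auto simp: eqv_iff)
  also have "\<dots> \<approx> \<^bold>Y \<^bold>\<bottom> \<^bold>\<and> \<^bold>Y \<phi>"
    unfolding eqv_def using assms(1) by (intro Y_Conj) auto
  finally show ?thesis
    using assms(3) by (auto dest: eqv_beval[OF _ assms(2)])
qed

lemma Box_Bot_eqv: "\<^bold>\<box> \<^bold>\<bottom> \<approx> \<^bold>\<bottom>"
  using admissibleD[OF Box_T[of "\<^bold>\<bottom>"]] by (auto simp: eqv_iff)

text \<open>Being at time 0 is common to all timelines. Writing \<open>Bot\<close> as its own box
  lets \<open>Y_Ctx\<close> move Y under a bracket; the bracket argument, Y applied to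
  \<open>Top\<close>, is a theorem and is discharged via \<open>Ctx_Box\<close>.\<close>

lemma Yest_Bot_eqv_Box: "\<^bold>Y \<^bold>\<bottom> \<approx> \<^bold>\<box> \<^bold>Y (\<^bold>\<bottom> :: 'a fm)"
proof -
  have "\<^bold>Y \<^bold>\<bottom> \<approx> \<^bold>Y \<^bold>\<box> (\<^bold>\<bottom> :: 'a fm)"
    using Box_Bot_eqv eqv_Yest eqv_sym by blast
  also have "\<dots> \<approx> \<^bold>[\<^bold>Y \<^bold>\<top>\<^bold>] \<^bold>Y \<^bold>\<bottom>"
    unfolding eqv_def by (intro Y_Ctx) auto
  also have "\<dots> \<approx> \<^bold>\<box> (\<^bold>Y \<^bold>\<top> \<^bold>\<rightarrow> \<^bold>Y \<^bold>\<bottom>)"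
    unfolding eqv_def by (intro Ctx_Box) auto
  also have "\<dots> \<approx> \<^bold>\<box> \<^bold>Y \<^bold>\<bottom>"
  proof (rule eqv_Ctx)
    have "derivable (\<^bold>Y (\<^bold>\<top> :: 'a fm))"
      by (intro Y_Nec Taut) (auto simp: tautology_def)
    from admissibleD[OF this] show "\<^bold>Y \<^bold>\<top> \<^bold>\<rightarrow> \<^bold>Y \<^bold>\<bottom> \<approx> \<^bold>Y (\<^bold>\<bottom> :: 'a fm)"
      by (auto simp: eqv_iff)
  qed simp
  finally show ?thesis .
qed

section \<open>Iterated next\<close>

abbreviation Nexts :: "nat \<Rightarrow> 'p fm \<Rightarrow> 'p fm" where
  "Nexts n \<equiv> Next ^^ n"

lemma is_Phi_Nexts [simp]: "is_Phi (Nexts n \<phi>) = is_Phi \<phi>"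
  by (induction n) auto

lemma is_XY_Nexts [simp]: "is_XY (Nexts n \<phi>) = is_XY \<phi>"
  by (induction n) auto

lemma eqv_Nexts: "\<phi> \<approx> \<psi> \<Longrightarrow> Nexts n \<phi> \<approx> Nexts n \<psi>"
  by (induction n) (auto intro: eqv_Next)

lemma Nexts_Neg_eqv: "is_Phi \<phi> \<Longrightarrow> Nexts n (\<^bold>\<not> \<phi>) \<approx> \<^bold>\<not> Nexts n \<phi>"
proof (induction n)
  case (Suc n)
  then have "\<^bold>X Nexts n (\<^bold>\<not> \<phi>) \<approx> \<^bold>X \<^bold>\<not> Nexts n \<phi>"
    by (simp add: eqv_Next)
  also have "\<dots> \<approx> \<^bold>\<not> \<^bold>X Nexts n \<phi>"
    unfolding eqv_def using Suc by (intro X_Neg) auto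
  finally show ?case
    by simp
qed (simp add: eqv_iff)

lemma Nexts_Conj_eqv:
  "is_Phi \<phi> \<Longrightarrow> is_Phi \<psi> \<Longrightarrow> Nexts n (\<phi> \<^bold>\<and> \<psi>) \<approx> Nexts n \<phi> \<^bold>\<and> Nexts n \<psi>"
proof (induction n)
  case (Suc n)
  then have "\<^bold>X Nexts n (\<phi> \<^bold>\<and> \<psi>) \<approx> \<^bold>X (Nexts n \<phi> \<^bold>\<and> Nexts n \<psi>)"
    by (simp add: eqv_Next)
  also have "\<dots> \<approx> \<^bold>X Nexts n \<phi> \<^bold>\<and> \<^bold>X Nexts n \<psi>"
    unfolding eqv_def using Suc by (intro X_Conj) auto
  finally show ?case
    by simp
qed (simp add: eqv_iff)

text \<open>\<open>Bot\<close> is equivalent to its conjunction with its negation; commuting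
  \<open>Nexts n\<close> with both connectives leaves a contradiction.\<close>

lemma Nexts_Bot_eqv: "Nexts n \<^bold>\<bottom> \<approx> \<^bold>\<bottom>"
proof -
  have "Nexts n \<^bold>\<bottom> \<approx> Nexts n (\<^bold>\<bottom> \<^bold>\<and> \<^bold>\<not> \<^bold>\<bottom>)"
    by (intro eqv_Nexts) (simp add: eqv_iff)
  also have "\<dots> \<approx> Nexts n \<^bold>\<bottom> \<^bold>\<and> Nexts n (\<^bold>\<not> \<^bold>\<bottom>)"
    by (intro Nexts_Conj_eqv) auto
  finally show ?thesis
    using Nexts_Neg_eqv[of "\<^bold>\<bottom>" n] by (auto simp: eqv_iff)
qed

lemma Nexts_Suc_Yest_eqv: "is_Phi \<phi> \<Longrightarrow> Nexts (Suc n) (\<^bold>Y \<phi>) \<approx> Nexts n \<phi>"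
  using eqv_Nexts[of "\<^bold>X \<^bold>Y \<phi>" \<phi> n] X_Y[of \<phi>] by (simp add: funpow_swap1 eqv_def)

lemma Next_Box_eqv:
  assumes "is_XY \<alpha>"
  shows "\<^bold>X \<^bold>\<box> \<alpha> \<approx> \<^bold>\<box> \<^bold>X \<alpha>"
proof -
  have "\<^bold>X \<^bold>\<box> \<alpha> \<approx> \<^bold>[\<^bold>X \<^bold>\<top>\<^bold>] \<^bold>X \<alpha>"
    unfolding eqv_def using assms by (intro X_Ctx) auto
  also have "\<dots> \<approx> \<^bold>\<box> (\<^bold>X \<^bold>\<top> \<^bold>\<rightarrow> \<^bold>X \<alpha>)"
    unfolding eqv_def using assms by (intro Ctx_Box) auto
  also have "\<dots> \<approx> \<^bold>\<box> \<^bold>X \<alpha>"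
  proof (rule eqv_Ctx)
    have "derivable (\<^bold>X (\<^bold>\<top> :: 'a fm))"
      by (intro X_Nec Taut) (auto simp: tautology_def)
    from admissibleD[OF this] show "\<^bold>X \<^bold>\<top> \<^bold>\<rightarrow> \<^bold>X \<alpha> \<approx> \<^bold>X \<alpha>"
      using assms by (auto simp: eqv_iff)
  qed simp
  finally show ?thesis .
qed

lemma Nexts_Box_eqv: "is_XY \<alpha> \<Longrightarrow> Nexts n (\<^bold>\<box> \<alpha>) \<approx> \<^bold>\<box> Nexts n \<alpha>"
proof (induction n)
  case (Suc n)
  then have "\<^bold>X Nexts n (\<^bold>\<box> \<alpha>) \<approx> \<^bold>X \<^bold>\<box> Nexts n \<alpha>"
    by (simp add: eqv_Next)
  also have "\<dots> \<approx> \<^bold>\<box> \<^bold>X Nexts n \<alpha>"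
    using Suc by (simp add: Next_Box_eqv)
  finally show ?case
    by simp
qed (simp add: eqv_iff)

text \<open>Descent: if X \<open>\<psi>\<close> is derivable, then so is Y X \<open>\<psi>\<close>,
  which \<open>Y_X\<close> turns into the disjunction of Y \<open>Bot\<close> and
  \<open>\<psi>\<close>; the second assumption settles the first disjunct. Here
  \<open>\<psi>\<close> runs through the formulas \<open>Nexts k \<phi>\<close>.\<close>

lemma derivable_from_shifts:
  assumes "is_Phi \<phi>" "\<And>k. k < n \<Longrightarrow> derivable (\<^bold>Y \<^bold>\<bottom> \<^bold>\<rightarrow> Nexts k \<phi>)" "derivable (Nexts n \<phi>)"
  shows "derivable \<phi>"
  using assms(2,3)
proof (induction n)
  case (Suc n)
  have "derivable (\<^bold>Y \<^bold>X Nexts n \<phi>)"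
    using Suc.prems(2) Y_Nec by force
  moreover have "derivable (\<^bold>Y \<^bold>\<bottom> \<^bold>\<rightarrow> Nexts n \<phi>)"
    using Suc.prems(1) by blast
  moreover have "derivable (\<^bold>Y \<^bold>X Nexts n \<phi> \<^bold>\<leftrightarrow> (\<^bold>Y \<^bold>\<bottom> \<^bold>\<or> Nexts n \<phi>))"
    using assms(1) by (intro Y_X) simp
  ultimately have "derivable (Nexts n \<phi>)"
    using assms(1) by (auto simp: derivable_iff_admissible)
  then show ?case
    using Suc by simp
qed simp

section \<open>Elimination of nested brackets\<close>

inductive elem :: "'p fm \<Rightarrow> bool" where
  XY: "is_XY \<alpha> \<Longrightarrow> elem \<alpha>"
| Box: "is_XY \<alpha> \<Longrightarrow> elem (\<^bold>\<box> \<alpha>)"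
| Neg: "elem \<phi> \<Longrightarrow> elem (\<^bold>\<not> \<phi>)"
| Conj: "elem \<phi> \<Longrightarrow> elem \<psi> \<Longrightarrow> elem (\<phi> \<^bold>\<and> \<psi>)"

lemma elem_is_Phi: "elem \<phi> \<Longrightarrow> is_Phi \<phi>"
  by (induction rule: elem.induct) auto

definition reducible :: "'p fm \<Rightarrow> bool" where
  "reducible \<phi> \<longleftrightarrow> (\<exists>e. elem e \<and> \<phi> \<approx> e)"

lemma elem_reducible: "elem e \<Longrightarrow> reducible e"
  unfolding reducible_def by (auto simp: eqv_iff elem_is_Phi)

lemma reducible_eqv: "\<phi> \<approx> \<psi> \<Longrightarrow> reducible \<psi> \<Longrightarrow> reducible \<phi>"
  unfolding reducible_def using eqv_trans by blast

lemma reducible_Neg: "reducible \<phi> \<Longrightarrow> reducible (\<^bold>\<not> \<phi>)"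
  unfolding reducible_def using eqv_Neg elem.Neg by blast

lemma reducible_Conj: "reducible \<phi> \<Longrightarrow> reducible \<psi> \<Longrightarrow> reducible (\<phi> \<^bold>\<and> \<psi>)"
  unfolding reducible_def using eqv_Conj elem.Conj by blast

lemma reducible_Disj: "reducible \<phi> \<Longrightarrow> reducible \<psi> \<Longrightarrow> reducible (\<phi> \<^bold>\<or> \<psi>)"
  by (intro reducible_Neg reducible_Conj)

lemma reducible_Ctx_XY: "is_XY \<alpha> \<Longrightarrow> is_XY \<beta> \<Longrightarrow> reducible (\<^bold>[\<alpha>\<^bold>] \<beta>)"
  by (rule reducible_eqv[OF Ctx_Box[folded eqv_def] elem_reducible[OF elem.Box]]) simp_all

lemma reducible_Next_elem: "elem e \<Longrightarrow> reducible (\<^bold>X e)"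
proof (induction rule: elem.induct)
  case (XY \<alpha>)
  then show ?case
    by (intro elem_reducible elem.XY) simp
next
  case (Box \<alpha>)
  then show ?case
    by (intro reducible_eqv[OF Next_Box_eqv] elem_reducible elem.Box) auto
next
  case (Neg \<phi>)
  then have "\<^bold>X \<^bold>\<not> \<phi> \<approx> \<^bold>\<not> \<^bold>X \<phi>"
    unfolding eqv_def by (intro X_Neg) (simp add: elem_is_Phi)
  then show ?case
    using Neg reducible_eqv reducible_Neg by blast
next
  case (Conj \<phi> \<psi>)
  then have "\<^bold>X (\<phi> \<^bold>\<and> \<psi>) \<approx> \<^bold>X \<phi> \<^bold>\<and> \<^bold>X \<psi>"
    unfolding eqv_def by (intro X_Conj) (simp_all add: elem_is_Phi)
  then show ?case
    using Conj reducible_eqv reducible_Conj by blast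
qed

text \<open>At time 0 the operator Y is not self-dual, so a negation leaves behind Y
  \<open>Bot\<close>, itself an X/Y-formula. A box turns into a bracket over an X/Y-formula, which
  \<open>reducible_Ctx_XY\<close> absorbs.\<close>

lemma reducible_Yest_elem: "elem e \<Longrightarrow> reducible (\<^bold>Y e)"
proof (induction rule: elem.induct)
  case (XY \<alpha>)
  then show ?case
    by (intro elem_reducible elem.XY) simp
next
  case (Box \<alpha>)
  then have "\<^bold>Y \<^bold>\<box> \<alpha> \<approx> \<^bold>[\<^bold>Y \<^bold>\<top>\<^bold>] \<^bold>Y \<alpha>"
    unfolding eqv_def by (intro Y_Ctx) auto
  then show ?case
    using Box by (elim reducible_eqv) (intro reducible_Ctx_XY; simp)
next
  case (Neg \<phi>)
  then have "\<^bold>Y \<^bold>\<not> \<phi> \<approx> \<^bold>Y \<^bold>\<bottom> \<^bold>\<or> \<^bold>\<not> \<^bold>Y \<phi>"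
    unfolding eqv_def by (intro Y_Neg) (simp add: elem_is_Phi)
  moreover have "reducible (\<^bold>Y \<^bold>\<bottom>)"
    by (intro elem_reducible elem.XY) simp
  ultimately show ?case
    using Neg reducible_eqv reducible_Neg reducible_Disj by blast
next
  case (Conj \<phi> \<psi>)
  then have "\<^bold>Y (\<phi> \<^bold>\<and> \<psi>) \<approx> \<^bold>Y \<phi> \<^bold>\<and> \<^bold>Y \<psi>"
    unfolding eqv_def by (intro Y_Conj) (simp_all add: elem_is_Phi)
  then show ?case
    using Conj reducible_eqv reducible_Conj by blast
qed

section \<open>Conjunctive normal forms over box literals\<close>

inductive box_literal :: "'p fm \<Rightarrow> bool" where
  pos: "is_XY \<gamma> \<Longrightarrow> box_literal (\<^bold>\<box> \<gamma>)"
| neg: "is_XY \<gamma> \<Longrightarrow> box_literal (\<^bold>\<not> \<^bold>\<box> \<gamma>)"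

lemma box_literal_closed: "box_literal l \<Longrightarrow> is_Phi l \<and> is_closed l"
  by (auto elim!: box_literal.cases)

text \<open>The outer bracket merges with the box, by \<open>Ctx_Ctx\<close> for a positive literal
  and by \<open>Ctx_CtxDual\<close> for a negative one.\<close>

lemma reducible_Ctx_box_literal:
  assumes "is_XY \<alpha>" "box_literal l"
  shows "reducible (\<^bold>[\<alpha>\<^bold>] l)"
  using assms(2)
proof cases
  case (pos \<gamma>)
  have "\<^bold>[\<alpha>\<^bold>] \<^bold>\<box> \<gamma> \<approx> \<^bold>[\<alpha> \<^bold>\<and> \<^bold>\<top>\<^bold>] \<gamma>"
    unfolding eqv_def using assms pos by (intro Ctx_Ctx) auto
  then show ?thesis
    using assms pos reducible_eqv reducible_Ctx_XY by (metis is_XY.simps(2-4))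
next
  case (neg \<gamma>)
  \<comment> \<open>A double negation under the box gives the literal the dual shape that
    \<open>Ctx_CtxDual\<close> expects.\<close>
  have "\<^bold>\<not> \<^bold>\<box> \<gamma> \<approx> \<^bold>\<langle>\<^bold>\<top>\<^bold>\<rangle> (\<^bold>\<not> \<gamma>)"
    using neg by (intro eqv_Neg eqv_Ctx) (auto simp: eqv_iff)
  then have "\<^bold>[\<alpha>\<^bold>] (\<^bold>\<not> \<^bold>\<box> \<gamma>) \<approx> \<^bold>[\<alpha>\<^bold>] \<^bold>\<langle>\<^bold>\<top>\<^bold>\<rangle> (\<^bold>\<not> \<gamma>)"
    using assms by (intro eqv_Ctx)
  also have "\<dots> \<approx> \<^bold>[\<alpha>\<^bold>] \<^bold>\<bottom> \<^bold>\<or> \<^bold>\<langle>\<alpha> \<^bold>\<and> \<^bold>\<top>\<^bold>\<rangle> (\<^bold>\<not> \<gamma>)"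
    unfolding eqv_def using assms neg by (intro Ctx_CtxDual) auto
  finally show ?thesis
    unfolding neg(1)
    by (rule reducible_eqv) (use assms neg in \<open>intro reducible_Disj reducible_Neg reducible_Ctx_XY; simp\<close>)
qed

text \<open>Literals are attached on the right, one at a time around the X/Y-part, because
  \<open>Ctx_Disj\<close> has its closed formula as right disjunct.\<close>

definition clause :: "'p fm \<times> 'p fm list \<Rightarrow> 'p fm" where
  "clause c = foldr (\<lambda>l \<phi>. \<phi> \<^bold>\<or> l) (snd c) (fst c)"

definition clause_set :: "('p fm \<times> 'p fm list) list \<Rightarrow> bool" where
  "clause_set cs \<longleftrightarrow> (\<forall>(\<beta>, ls) \<in> set cs. is_XY \<beta> \<and> (\<forall>l \<in> set ls. box_literal l))"

definition has_cnf :: "'p fm \<Rightarrow> bool" where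
  "has_cnf \<phi> \<longleftrightarrow> (\<exists>cs. clause_set cs \<and> (\<forall>v. beval v \<phi> \<longleftrightarrow> (\<forall>c \<in> set cs. beval v (clause c))))"

lemma beval_clause: "beval v (clause (\<beta>, ls)) \<longleftrightarrow> beval v \<beta> \<or> (\<exists>l \<in> set ls. beval v l)"
  by (induction ls) (auto simp: clause_def)

lemma has_cnf_XY:
  assumes "is_XY \<beta>"
  shows "has_cnf \<beta>"
  unfolding has_cnf_def
  by (rule exI[of _ "[(\<beta>, [])]"]) (auto simp: clause_set_def beval_clause assms)

lemma has_cnf_box_literal:
  assumes "box_literal l"
  shows "has_cnf l"
  unfolding has_cnf_def
  by (rule exI[of _ "[(\<^bold>\<bottom>, [l])]"]) (auto simp: clause_set_def beval_clause assms)

lemma has_cnf_cong: "has_cnf \<phi> \<Longrightarrow> (\<And>v. beval v \<psi> = beval v \<phi>) \<Longrightarrow> has_cnf \<psi>"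
  unfolding has_cnf_def by simp

lemma has_cnf_Conj:
  assumes "has_cnf \<phi>" "has_cnf \<psi>"
  shows "has_cnf (\<phi> \<^bold>\<and> \<psi>)"
proof -
  obtain cs ds where "clause_set cs" "\<forall>v. beval v \<phi> \<longleftrightarrow> (\<forall>c \<in> set cs. beval v (clause c))"
    "clause_set ds" "\<forall>v. beval v \<psi> \<longleftrightarrow> (\<forall>c \<in> set ds. beval v (clause c))"
    using assms unfolding has_cnf_def by blast
  then show ?thesis
    unfolding has_cnf_def by (intro exI[of _ "cs @ ds"]) (auto simp: clause_set_def)
qed

lemma has_cnf_Disj:
  assumes "has_cnf \<phi>" "has_cnf \<psi>"
  shows "has_cnf (\<phi> \<^bold>\<or> \<psi>)"
proof -
  obtain cs ds where cs: "clause_set cs" "\<And>v. beval v \<phi> \<longleftrightarrow> (\<forall>c \<in> set cs. beval v (clause c))"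
    and ds: "clause_set ds" "\<And>v. beval v \<psi> \<longleftrightarrow> (\<forall>c \<in> set ds. beval v (clause c))"
    using assms unfolding has_cnf_def by blast
  \<comment> \<open>Distributivity: each pair of clauses yields one clause.\<close>
  define join :: "('a fm \<times> 'a fm list) \<times> ('a fm \<times> 'a fm list) \<Rightarrow> 'a fm \<times> 'a fm list"
    where "join = (\<lambda>((\<beta>, ls), (\<gamma>, ks)). (\<beta> \<^bold>\<or> \<gamma>, ls @ ks))"
  have join: "beval v (clause (join (c, d))) \<longleftrightarrow> beval v (clause c) \<or> beval v (clause d)" for v c d
    by (cases c; cases d) (auto simp: join_def beval_clause)
  have "clause_set (map join (List.product cs ds))"
    using cs(1) ds(1) unfolding clause_set_def join_def by fastforce
  moreover have "beval v (\<phi> \<^bold>\<or> \<psi>) \<longleftrightarrow> (\<forall>c \<in> set (map join (List.product cs ds)). beval v (clause c))" for v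
    using cs(2)[of v] ds(2)[of v] join[of v] by auto
  ultimately show ?thesis
    unfolding has_cnf_def by blast
qed

text \<open>The negation is carried along so that the case \<open>Neg\<close> merely exchanges the
  two claims.\<close>

lemma elem_has_cnf: "elem e \<Longrightarrow> has_cnf e \<and> has_cnf (\<^bold>\<not> e)"
proof (induction rule: elem.induct)
  case (Conj \<phi> \<psi>)
  then have "has_cnf (\<^bold>\<not> \<phi> \<^bold>\<or> \<^bold>\<not> \<psi>)"
    using has_cnf_Disj by blast
  then have "has_cnf (\<^bold>\<not> (\<phi> \<^bold>\<and> \<psi>))"
    by (rule has_cnf_cong) auto
  then show ?case
    using Conj has_cnf_Conj by blast
next
  case (Neg \<phi>)
  then have "has_cnf (\<^bold>\<not> \<^bold>\<not> \<phi>)"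
    by (auto intro: has_cnf_cong)
  then show ?case
    using Neg by blast
qed (auto intro: has_cnf_XY has_cnf_box_literal box_literal.intros)

lemma reducible_Ctx_clause:
  assumes "is_XY \<alpha>" "is_XY \<beta>" "\<forall>l \<in> set ls. box_literal l"
  shows "is_Phi (clause (\<beta>, ls)) \<and> reducible (\<^bold>[\<alpha>\<^bold>] clause (\<beta>, ls))"
  using assms(3)
proof (induction ls)
  case Nil
  then show ?case
    using assms by (simp add: clause_def reducible_Ctx_XY)
next
  case (Cons l ls)
  have eq: "clause (\<beta>, l # ls) = clause (\<beta>, ls) \<^bold>\<or> l"
    by (simp add: clause_def)
  have "\<^bold>[\<alpha>\<^bold>] (clause (\<beta>, ls) \<^bold>\<or> l) \<approx> \<^bold>[\<alpha>\<^bold>] clause (\<beta>, ls) \<^bold>\<or> \<^bold>[\<alpha>\<^bold>] l"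
    unfolding eqv_def using Cons assms box_literal_closed by (intro Ctx_Disj) auto
  moreover have "reducible (\<^bold>[\<alpha>\<^bold>] clause (\<beta>, ls) \<^bold>\<or> \<^bold>[\<alpha>\<^bold>] l)"
    using Cons assms by (simp add: reducible_Disj reducible_Ctx_box_literal)
  ultimately show ?case
    unfolding eq using Cons box_literal_closed reducible_eqv by auto
qed

lemma reducible_Ctx_clauses:
  assumes "is_XY \<alpha>" "clause_set cs"
  shows "is_Phi (foldr (\<lambda>c \<phi>. clause c \<^bold>\<and> \<phi>) cs \<^bold>\<top>) \<and>
    reducible (\<^bold>[\<alpha>\<^bold>] foldr (\<lambda>c \<phi>. clause c \<^bold>\<and> \<phi>) cs \<^bold>\<top>)"
  using assms(2)
proof (induction cs)
  case Nil
  then show ?case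
    using assms by (simp add: reducible_Ctx_XY)
next
  case (Cons c cs)
  let ?r = "foldr (\<lambda>c \<phi>. clause c \<^bold>\<and> \<phi>) cs \<^bold>\<top>"
  obtain \<beta> ls where c: "c = (\<beta>, ls)"
    by fastforce
  have 1: "is_Phi (clause c) \<and> reducible (\<^bold>[\<alpha>\<^bold>] clause c)"
    using Cons.prems assms(1) unfolding c clause_set_def by (intro reducible_Ctx_clause) auto
  have 2: "is_Phi ?r \<and> reducible (\<^bold>[\<alpha>\<^bold>] ?r)"
    using Cons unfolding clause_set_def by simp
  have "\<^bold>[\<alpha>\<^bold>] (clause c \<^bold>\<and> ?r) \<approx> \<^bold>[\<alpha>\<^bold>] clause c \<^bold>\<and> \<^bold>[\<alpha>\<^bold>] ?r"
    unfolding eqv_def using 1 2 assms(1) by (intro Ctx_Conj) auto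
  then show ?case
    using 1 2 reducible_eqv reducible_Conj by fastforce
qed

text \<open>Once \<open>e\<close> is replaced by its normal form, the bracket distributes over the
  clauses by \<open>Ctx_Conj\<close> and over their literals by \<open>Ctx_Disj\<close>, until it
  stands before literals and X/Y-formulas only.\<close>

lemma reducible_Ctx_elem:
  assumes "is_XY \<alpha>" "elem e"
  shows "reducible (\<^bold>[\<alpha>\<^bold>] e)"
proof -
  obtain cs where cs: "clause_set cs" "\<And>v. beval v e \<longleftrightarrow> (\<forall>c \<in> set cs. beval v (clause c))"
    using elem_has_cnf[OF assms(2)] unfolding has_cnf_def by blast
  let ?f = "foldr (\<lambda>c \<phi>. clause c \<^bold>\<and> \<phi>) cs \<^bold>\<top>"
  have "beval v ?f \<longleftrightarrow> (\<forall>c \<in> set cs. beval v (clause c))" for v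
    by (induction cs) auto
  then have "e \<approx> ?f"
    using cs reducible_Ctx_clauses[OF assms(1)] assms(2) by (auto simp: eqv_iff elem_is_Phi)
  then have "\<^bold>[\<alpha>\<^bold>] e \<approx> \<^bold>[\<alpha>\<^bold>] ?f"
    by (rule eqv_Ctx[OF assms(1)])
  then show ?thesis
    using cs reducible_Ctx_clauses[OF assms(1)] reducible_eqv by blast
qed

text \<open>Brackets are eliminated from the inside out; the argument of a bracket is already an
  X/Y-formula.\<close>

lemma is_Phi_reducible: "is_Phi \<phi> \<Longrightarrow> reducible \<phi>"
proof (induction \<phi>)
  case (Next \<phi>)
  then obtain e where "elem e" "\<phi> \<approx> e"
    unfolding reducible_def by auto
  then show ?case
    using eqv_Next reducible_eqv reducible_Next_elem by blast
next
  case (Yest \<phi>)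
  then obtain e where "elem e" "\<phi> \<approx> e"
    unfolding reducible_def by auto
  then show ?case
    using eqv_Yest reducible_eqv reducible_Yest_elem by blast
next
  case (Ctx \<alpha> \<phi>)
  then obtain e where "elem e" "\<phi> \<approx> e" and "is_XY \<alpha>"
    unfolding reducible_def by auto
  then show ?case
    using eqv_Ctx reducible_eqv reducible_Ctx_elem by blast
qed (simp_all add: reducible_Neg reducible_Conj elem_reducible elem.XY)

section \<open>Trees from families of words\<close>

text \<open>
  All branches share only the root. The root is coded by \<open>0\<close> and position \<open>n + 1\<close> of the
  \<open>j\<close>-th branch by the successor of the code of the pair \<open>(j, n)\<close>; the codes are then embedded
  into the given infinite type.
\<close>

definition node :: "nat \<Rightarrow> nat \<Rightarrow> nat" where
  "node j n = (case n of 0 \<Rightarrow> 0 | Suc m \<Rightarrow> Suc (prod_encode (j, m)))"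

lemma node_eq_iff: "node j n = node j' n' \<longleftrightarrow> n = n' \<and> (n = 0 \<or> j = j')"
  by (auto simp: node_def split: nat.splits)

lemma tree_model_of_words:
  fixes w :: "nat \<Rightarrow> nat \<Rightarrow> 'p set"
  assumes root: "\<And>j j'. w j 0 = w j' 0"
  obtains M :: "('w::infinite, 'p) model" and \<pi> :: "nat \<Rightarrow> nat \<Rightarrow> 'w"
  where "is_model M" "\<And>j. \<pi> j \<in> TL M" "\<And>j n p. \<pi> j n \<in> val M p \<longleftrightarrow> p \<in> w j n"
proof -
  obtain f :: "nat \<Rightarrow> 'w" where f: "inj f"
    using infinite_countable_subset[OF infinite_UNIV] by blast
  define \<pi> where "\<pi> j n = f (node j n)" for j n
  \<comment> \<open>A node determines its depth and, away from the root, its branch; hence the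
    unique predecessors in \<open>rel\<close>.\<close>
  have \<pi>_eq: "\<pi> j n = \<pi> j' n' \<longleftrightarrow> n = n' \<and> (n = 0 \<or> j = j')" for j n j' n'
    using f by (simp add: \<pi>_def inj_eq node_eq_iff)
  define M :: "('w, 'p) model" where
    "M = \<lparr>worlds = {\<pi> j n | j n. True}, rel = {(\<pi> j n, \<pi> j (Suc n)) | j n. True},
          val = (\<lambda>p. {\<pi> j n | j n. p \<in> w j n})\<rparr>"
  have rel: "(x, \<pi> j n) \<in> rel M \<longleftrightarrow> (\<exists>m. n = Suc m \<and> x = \<pi> j m)" for x j n
    unfolding M_def using \<pi>_eq by fastforce
  have path: "is_path M (\<pi> 0 0) (map (\<pi> j) [0..<Suc n]) (\<pi> j n)" for j n
  proof (induction n)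
    case 0
    then show ?case
      by (simp add: is_path_def \<pi>_eq)
  next
    case (Suc n)
    then show ?case
      unfolding is_path_def by (auto simp: successively_append_iff rel hd_append)
  qed
  \<comment> \<open>Read backwards from its end, a path is forced step by step, so the induction
    removes last elements.\<close>
  have uniq: "xs = map (\<pi> j) [0..<Suc n]" if "is_path M (\<pi> 0 0) xs (\<pi> j n)" for xs j n
    using that
  proof (induction xs arbitrary: n rule: rev_induct)
    case Nil
    then show ?case
      by (simp add: is_path_def)
  next
    case (snoc x xs)
    have x: "x = \<pi> j n"
      using snoc.prems by (simp add: is_path_def)
    show ?case
    proof (cases "xs = []")
      case True
      then show ?thesis
        using snoc.prems x by (simp add: is_path_def \<pi>_eq)
    next
      case False
      then have "(last xs, \<pi> j n) \<in> rel M"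
        using snoc.prems x unfolding is_path_def by (simp add: successively_append_iff)
      then obtain m where m: "n = Suc m" "last xs = \<pi> j m"
        using rel by blast
      then have "is_path M (\<pi> 0 0) xs (\<pi> j m)"
        using snoc.prems False unfolding is_path_def by (simp add: successively_append_iff)
      then show ?thesis
        using snoc.IH x m by simp
    qed
  qed
  have "is_root M (\<pi> 0 0)"
    unfolding is_root_def
  proof (intro conjI ballI)
    show "\<pi> 0 0 \<in> worlds M"
      unfolding M_def by auto
    fix x assume "x \<in> worlds M"
    then obtain j n where "x = \<pi> j n"
      unfolding M_def by auto
    then show "\<exists>!xs. is_path M (\<pi> 0 0) xs x"
      using path uniq by blast
  qed
  moreover have "\<pi> j 0 = \<pi> 0 0" for j
    by (simp add: \<pi>_eq)
  ultimately have roots: "is_root M (\<pi> j 0)" for j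
    by metis
  have "is_model M"
    unfolding is_model_def using roots unfolding M_def by auto
  moreover have "\<pi> j \<in> TL M" for j
    using roots rel unfolding TL_def by blast
  moreover have "\<pi> j n \<in> val M p \<longleftrightarrow> p \<in> w j n" for j n p
  proof -
    have "\<pi> j n \<in> val M p \<longleftrightarrow> (\<exists>j' n'. \<pi> j n = \<pi> j' n' \<and> p \<in> w j' n')"
      unfolding M_def by auto
    \<comment> \<open>Two branches meet only at depth 0, where \<open>root\<close> makes their
      labels agree.\<close>
    then show ?thesis
      using \<pi>_eq root by metis
  qed
  ultimately show thesis
    using that by blast
qed

section \<open>Completeness\<close>

instance fm :: (countable) countable
  by countable_datatype

text \<open>An upper bound on the steps back that evaluation takes; an X is not credited against a Y
  below it.\<close>

primrec ydepth :: "'p fm \<Rightarrow> nat" where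
  "ydepth (Atom p) = 0"
| "ydepth \<^bold>\<bottom> = 0"
| "ydepth (\<^bold>\<not> \<phi>) = ydepth \<phi>"
| "ydepth (\<phi> \<^bold>\<and> \<psi>) = max (ydepth \<phi>) (ydepth \<psi>)"
| "ydepth (\<^bold>X \<phi>) = ydepth \<phi>"
| "ydepth (\<^bold>Y \<phi>) = Suc (ydepth \<phi>)"
| "ydepth (\<^bold>[\<alpha>\<^bold>] \<phi>) = max (ydepth \<alpha>) (ydepth \<phi>)"

text \<open>Time \<open>n + d\<close> lies \<open>n\<close> steps after the point described by
  \<open>u\<close>. Stepping back from \<open>n = 0\<close> must be harmless or excluded: either
  that point is time 0, where every Y-formula holds, or \<open>n\<close> is at least the number of
  nested Y still to be crossed.\<close>

lemma truth_XY:
  assumes "admissible u"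
    and "\<And>n p. \<pi> (n + d) \<in> val M p \<longleftrightarrow> beval u (Nexts n (Atom p))"
    and "is_XY \<alpha>" "d = 0 \<and> beval u (\<^bold>Y \<^bold>\<bottom>) \<or> ydepth \<alpha> \<le> n"
  shows "sat M C \<pi> (n + d) \<alpha> \<longleftrightarrow> beval u (Nexts n \<alpha>)"
  using assms(3,4)
proof (induction \<alpha> arbitrary: n)
  case (Atom p)
  then show ?case
    using assms(2) by simp
next
  case Bot
  then show ?case
    using eqv_beval[OF Nexts_Bot_eqv assms(1)] by simp
next
  case (Neg \<alpha>)
  then show ?case
    using eqv_beval[OF Nexts_Neg_eqv assms(1)] by simp
next
  case (Conj \<alpha> \<beta>)
  then show ?case
    using eqv_beval[OF Nexts_Conj_eqv assms(1)] by auto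
next
  case (Next \<alpha>)
  have "sat M C \<pi> (Suc n + d) \<alpha> \<longleftrightarrow> beval u (Nexts (Suc n) \<alpha>)"
    using Next.prems by (intro Next.IH) auto
  then show ?case
    by (simp add: funpow_swap1)
next
  case (Yest \<alpha>)
  show ?case
  proof (cases n)
    case 0
    then have "d = 0" "beval u (\<^bold>Y \<^bold>\<bottom>)"
      using Yest.prems by auto
    then show ?thesis
      using Yest_Bot_imp_Yest[OF _ assms(1), of \<alpha>] Yest.prems 0 by simp
  next
    case (Suc m)
    have "sat M C \<pi> (m + d) \<alpha> \<longleftrightarrow> beval u (Nexts m \<alpha>)"
      using Yest.prems Suc by (intro Yest.IH) auto
    then show ?thesis
      using eqv_beval[OF Nexts_Suc_Yest_eqv assms(1), of \<alpha> m] Yest.prems Suc by simp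
  qed
qed simp

text \<open>Lindenbaum's lemma is applied to the consequences of the X/Y-formulas boxed at
  \<open>v\<close>. They are closed under modus ponens because boxed premises can be conjoined, and
  they omit \<open>\<gamma>\<close> by \<open>Box_mono\<close>.\<close>

lemma Box_witness:
  assumes "admissible v" "is_XY \<gamma>" "\<not> beval v (\<^bold>\<box> \<gamma>)"
  obtains u where "admissible u" "\<And>\<beta>. is_XY \<beta> \<Longrightarrow> beval v (\<^bold>\<box> \<beta>) \<Longrightarrow> beval u \<beta>" "\<not> beval u \<gamma>"
proof -
  define T where "T = {\<phi>. \<exists>\<beta>. is_XY \<beta> \<and> beval v (\<^bold>\<box> \<beta>) \<and> derivable (\<beta> \<^bold>\<rightarrow> \<phi>)}"
  \<comment> \<open>With \<open>Top\<close> as boxed premise, every theorem enters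
    \<open>T\<close>.\<close>
  have "beval v (\<^bold>\<box> \<^bold>\<top>)"
    by (intro admissibleD[OF Box_Nec[OF _ Taut] assms(1)]) (auto simp: tautology_def)
  then have der: "\<phi> \<in> T" if "derivable \<phi>" for \<phi>
    using that derivable_is_Phi[OF that] unfolding T_def
    by (auto simp: derivable_iff_admissible intro!: exI[of _ "\<^bold>\<top>"])
  have mp: "\<psi> \<in> T" if h: "is_Phi \<phi>" "is_Phi \<psi>" "(\<phi> \<^bold>\<rightarrow> \<psi>) \<in> T" "\<phi> \<in> T" for \<phi> \<psi>
  proof -
    obtain \<beta>1 \<beta>2 where b: "is_XY \<beta>1" "is_XY \<beta>2" "beval v (\<^bold>\<box> \<beta>1)" "beval v (\<^bold>\<box> \<beta>2)"
      "derivable (\<beta>1 \<^bold>\<rightarrow> (\<phi> \<^bold>\<rightarrow> \<psi>))" "derivable (\<beta>2 \<^bold>\<rightarrow> \<phi>)"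
      using h unfolding T_def by blast
    have "beval v (\<^bold>\<box> (\<beta>1 \<^bold>\<and> \<beta>2))"
      using eqv_beval[OF Box_Conj_eqv assms(1)] b by simp
    moreover have "derivable (\<beta>1 \<^bold>\<and> \<beta>2 \<^bold>\<rightarrow> \<psi>)"
      using b h(1,2) by (auto simp: derivable_iff_admissible)
    ultimately show ?thesis
      using b unfolding T_def by (auto intro!: exI[of _ "\<beta>1 \<^bold>\<and> \<beta>2"])
  qed
  have "\<gamma> \<notin> T"
    using Box_mono[OF _ assms(2) _ assms(1)] assms(3) unfolding T_def by blast
  obtain u where u: "\<And>\<phi>. is_Phi \<phi> \<Longrightarrow> \<phi> \<in> T \<Longrightarrow> beval u \<phi>" "\<not> beval u \<gamma>"
  proof (rule lindenbaum)
    show "\<phi> \<in> T" if "is_Phi \<phi>" "tautology \<phi>" for \<phi>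
      by (intro der Taut) (use that in simp_all)
    show "is_Phi \<gamma>"
      using assms(2) by simp
  qed (rule mp, assumption+, rule \<open>\<gamma> \<notin> T\<close>, blast)
  have "beval u \<beta>" if "is_XY \<beta>" "beval v (\<^bold>\<box> \<beta>)" for \<beta>
  proof (rule u(1))
    have "derivable (\<beta> \<^bold>\<rightarrow> \<beta>)"
      using that by (intro Taut) (auto simp: tautology_def)
    then show "\<beta> \<in> T"
      using that unfolding T_def by blast
  qed (use that in simp)
  moreover have "admissible u"
    using u(1) der derivable_is_Phi unfolding admissible_def by blast
  ultimately show thesis
    using that u(2) by blast
qed

text \<open>Read contrapositively, the axiom \<open>Root\<close> boxes the negation of each
  propositional formula false at \<open>v\<close>. Applied to \<open>p\<close> and to its negation,
  this fixes the value of \<open>p\<close> at \<open>u\<close>.\<close>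

lemma Root_atoms_agree:
  assumes "admissible v" "beval v (\<^bold>Y \<^bold>\<bottom>)" "\<And>\<beta>. is_XY \<beta> \<Longrightarrow> beval v (\<^bold>\<box> \<beta>) \<Longrightarrow> beval u \<beta>"
  shows "beval u (Atom p) \<longleftrightarrow> beval v (Atom p)"
proof -
  have "derivable (\<^bold>\<box> (\<^bold>\<not> \<^bold>Y \<^bold>\<bottom>) \<^bold>\<rightarrow> \<^bold>\<not> \<^bold>Y \<^bold>\<bottom>)"
    by (intro Box_T) simp
  then have "beval v (\<^bold>\<diamond> \<^bold>Y \<^bold>\<bottom>)"
    using assms(2) admissibleD[OF _ assms(1)] by fastforce
  moreover have "beval v (\<^bold>\<diamond> \<^bold>Y \<^bold>\<bottom> \<^bold>\<rightarrow> (\<^bold>\<diamond> \<alpha> \<^bold>\<rightarrow> \<alpha>))" if "is_PL \<alpha>" for \<alpha>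
    using that by (intro admissibleD[OF Root assms(1)]) simp
  ultimately have dia: "beval v (\<^bold>\<box> (\<^bold>\<not> \<alpha>)) \<or> beval v \<alpha>" if "is_PL \<alpha>" for \<alpha>
    using that by fastforce
  show ?thesis
    using dia[of "Atom p"] dia[of "\<^bold>\<not> Atom p"] assms(3)[of "\<^bold>\<not> Atom p"]
      assms(3)[of "\<^bold>\<not> \<^bold>\<not> Atom p"] by auto
qed

text \<open>The timelines are \<open>v\<close> and one witness for each box failing at
  \<open>v\<close>; these suffice since \<open>e\<close> does not nest boxes. Formulas being
  countable, so are the branches, and the tree fits into any infinite type.\<close>

lemma countermodel:
  fixes v :: "'p::countable fm \<Rightarrow> bool"
  assumes v: "admissible v" and e: "elem e" and depth: "beval v (\<^bold>Y \<^bold>\<bottom>) \<or> ydepth e \<le> k"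
  obtains M :: "('w::infinite, 'p) model" and C \<pi> i
  where "is_model M" "is_context M C" "\<pi> \<in> AT M C" "sat M C \<pi> i e \<longleftrightarrow> beval v (Nexts k e)"
proof -
  define S where "S = {u. admissible u \<and> (\<forall>\<beta>. is_XY \<beta> \<longrightarrow> beval v (\<^bold>\<box> \<beta>) \<longrightarrow> beval u \<beta>)}"
  define fails where "fails = {\<gamma>. is_XY \<gamma> \<and> \<not> beval v (\<^bold>\<box> \<gamma>)}"
  have "\<exists>u \<in> S. \<not> beval u \<gamma>" if "\<gamma> \<in> fails" for \<gamma>
    using that Box_witness[OF v, of \<gamma>] unfolding S_def fails_def by blast
  then obtain g where g: "\<And>\<gamma>. \<gamma> \<in> fails \<Longrightarrow> g \<gamma> \<in> S \<and> \<not> beval (g \<gamma>) \<gamma>"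
    by metis
  have "v \<in> S"
    using v admissibleD[OF Box_T v] unfolding S_def by auto
  define U where "U = from_nat_into (insert v (g ` fails))"
  have rangeU: "range U = insert v (g ` fails)"
    unfolding U_def by (intro range_from_nat_into) auto
  then have US: "U j \<in> S" for j
    using g \<open>v \<in> S\<close> by (metis imageE insert_iff rangeI)
  \<comment> \<open>All branches must carry the same label at the root. If \<open>v\<close> is at
    time 0, \<open>Root_atoms_agree\<close> ensures this; otherwise a dummy root with empty label is
    put in front and everything moves one step later.\<close>
  define d :: nat where "d = (if beval v (\<^bold>Y \<^bold>\<bottom>) then 0 else 1)"
  define w where "w j n = {p. d \<le> n \<and> beval (U j) (Nexts (n - d) (Atom p))}" for j n
  have "beval (U j) (Atom p) \<longleftrightarrow> beval v (Atom p)" if "beval v (\<^bold>Y \<^bold>\<bottom>)" for j p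
    using US[of j] by (intro Root_atoms_agree[OF v that]) (simp add: S_def)
  then have "w j 0 = w j' 0" for j j'
    unfolding w_def d_def by auto
  then obtain M :: "('w, 'p) model" and \<pi> where M: "is_model M" "\<And>j. \<pi> j \<in> TL M"
    "\<And>j n p. \<pi> j n \<in> val M p \<longleftrightarrow> p \<in> w j n"
    using tree_model_of_words[of w] by metis
  \<comment> \<open>This context makes the available timelines exactly the constructed branches,
    whatever else \<open>TL M\<close> may contain.\<close>
  define C where "C = {range \<pi>}"
  have C: "is_context M C" and AT: "AT M C = range \<pi>"
    using M(2) unfolding C_def is_context_def AT_def by auto
  have UY: "beval (U j) (\<^bold>Y \<^bold>\<bottom>)" if "beval v (\<^bold>Y \<^bold>\<bottom>)" for j
  proof -
    have "beval v (\<^bold>\<box> \<^bold>Y \<^bold>\<bottom>)"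
      using that eqv_beval[OF Yest_Bot_eqv_Box v] by simp
    moreover have "is_XY (\<^bold>Y (\<^bold>\<bottom> :: 'p fm))"
      by simp
    ultimately show ?thesis
      using US[of j] unfolding S_def by blast
  qed
  have truth: "sat M C (\<pi> j) (k + d) \<alpha> \<longleftrightarrow> beval (U j) (Nexts k \<alpha>)"
    if "is_XY \<alpha>" "beval v (\<^bold>Y \<^bold>\<bottom>) \<or> ydepth \<alpha> \<le> k" for \<alpha> j
  proof (rule truth_XY)
    show "admissible (U j)"
      using US unfolding S_def by blast
    show "\<pi> j (n + d) \<in> val M p \<longleftrightarrow> beval (U j) (Nexts n (Atom p))" for n p
      by (simp add: M(3) w_def)
    show "d = 0 \<and> beval (U j) (\<^bold>Y \<^bold>\<bottom>) \<or> ydepth \<alpha> \<le> k"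
      using that(2) UY unfolding d_def by auto
  qed fact
  obtain j where j: "U j = v"
    using rangeU by (metis imageE insertI1)
  have "sat M C (\<pi> j) (k + d) e \<longleftrightarrow> beval v (Nexts k e)"
    using e depth
  proof (induction rule: elem.induct)
    case (XY \<alpha>)
    then show ?case
      using truth[of \<alpha> j] j by simp
  next
    case (Box \<alpha>)
    \<comment> \<open>The semantic box ranges over the branches, the canonical one over accessible
      valuations. Both agree because a box failing at \<open>v\<close> has its witness among the
      \<open>U i\<close>.\<close>
    have "sat M C (\<pi> j) (k + d) (\<^bold>\<box> \<alpha>) \<longleftrightarrow> (\<forall>i. beval (U i) (Nexts k \<alpha>))"
      using Box truth[of \<alpha>] by (simp add: sat_Ctx_XY AT del: sat.simps(7))
    also have "\<dots> \<longleftrightarrow> beval v (\<^bold>\<box> Nexts k \<alpha>)"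
    proof
      assume all: "\<forall>i. beval (U i) (Nexts k \<alpha>)"
      show "beval v (\<^bold>\<box> Nexts k \<alpha>)"
      proof (rule ccontr)
        assume "\<not> beval v (\<^bold>\<box> Nexts k \<alpha>)"
        then have "Nexts k \<alpha> \<in> fails"
          using Box unfolding fails_def by simp
        moreover from this obtain i where "U i = g (Nexts k \<alpha>)"
          using rangeU by (metis imageE imageI insertI2)
        ultimately show False
          using g all by metis
      qed
    next
      assume "beval v (\<^bold>\<box> Nexts k \<alpha>)"
      then show "\<forall>i. beval (U i) (Nexts k \<alpha>)"
        using US Box unfolding S_def by auto
    qed
    finally show ?case
      using eqv_beval[OF Nexts_Box_eqv v] Box by simp
  next
    case (Neg \<phi>)
    then show ?case
      using eqv_beval[OF Nexts_Neg_eqv v] by (simp add: elem_is_Phi)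
  next
    case (Conj \<phi> \<psi>)
    then show ?case
      using eqv_beval[OF Nexts_Conj_eqv v] by (auto simp: elem_is_Phi)
  qed
  then show thesis
    using that[OF M(1) C, of "\<pi> j"] AT by blast
qed

lemma completeness_elem:
  fixes e :: "'p::countable fm"
  assumes e: "elem e" and valid: "valid TYPE('w::infinite) e"
  shows "derivable e"
proof -
  \<comment> \<open>Otherwise \<open>countermodel\<close> would refute \<open>e\<close>. The two
    alternatives are what \<open>derivable_from_shifts\<close> asks for with \<open>n\<close> taken
    as \<open>ydepth e\<close>.\<close>
  have true: "beval v (Nexts k e)" if "admissible v" "beval v (\<^bold>Y \<^bold>\<bottom>) \<or> ydepth e \<le> k" for v k
    using countermodel[OF that(1) e that(2), where 'w = 'w] valid unfolding valid_def by metis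
  show ?thesis
  proof (rule derivable_from_shifts)
    show "is_Phi e"
      using e by (rule elem_is_Phi)
    then show "derivable (\<^bold>Y \<^bold>\<bottom> \<^bold>\<rightarrow> Nexts k e)" for k
      using true by (subst derivable_iff_admissible) auto
    show "derivable (Nexts (ydepth e) e)"
      using \<open>is_Phi e\<close> true by (subst derivable_iff_admissible) auto
  qed
qed

theorem theorem1:
  fixes \<phi> :: "'p::countable fm"
  assumes "\<phi> \<in> \<Phi>"
  shows "derivable \<phi> \<longleftrightarrow> valid TYPE('w::infinite) \<phi>"
proof
  assume "derivable \<phi>"
  then show "valid TYPE('w) \<phi>"
    unfolding valid_def using soundness by blast
next
  assume valid: "valid TYPE('w) \<phi>"
  obtain e where e: "elem e" "\<phi> \<approx> e"
    using is_Phi_reducible assms unfolding reducible_def by auto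
  \<comment> \<open>Soundness makes the provable equivalence valid, so validity passes from
    \<open>\<phi>\<close> to its reduced form.\<close>
  then have "valid TYPE('w) (\<phi> \<^bold>\<leftrightarrow> e)"
    unfolding valid_def eqv_def using soundness by blast
  then have "valid TYPE('w) e"
    using valid unfolding valid_def by fastforce
  then have "derivable e"
    using e(1) completeness_elem by blast
  then show "derivable \<phi>"
    using e(2) assms by (simp add: derivable_iff_admissible eqv_iff)
qed

end
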